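(* If a dynamical system $(X,T)$ is transitive and has the shadowing property, then the collection of invariant measures with zero entropy is dense in $M_T(X)$. If in addition the entropy function $M_T(X)\to[0,\infty]$, $\mu\mapsto h_\mu(T)$, is upper semi-continuous, then the collection of invariant measures with zero entropy is residual in $M_T(X)$.
   Context: A dynamical system $(X,T)$ is a compact metric space $(X,d)$ with a continuous map $T\colon X\to X$ (not necessarily invertible). It is transitive if for any two nonempty open sets $U,V\subset X$ there is $n>0$ with $T^n(U)\cap V\neq\emptyset$. A sequence $(x_n)_{n=0}^\infty$ in $X$ is a $\delta$-pseudo-orbit if $d(T(x_n),x_{n+1})<\delta$ for all $n\ge 0$; it is $\varepsilon$-traced by $y\in X$ if $d(T^n(y),x_n)<\varepsilon$ for all $n\ge 0$. $(X,T)$ has the shadowing property if for every $\varepsilon>0$ there is $\delta>0$ such that every $\delta$-pseudo-orbit is $\varepsilon$-traced by some point of $X$. $M_T(X)$ is the space of $T$-invariant Borel probability measures on $X$ with the weak$^*$-topology, and $h_\mu(T)$ is the measure-theoretic entropy. Residual means having complement of first category. *)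

theory Defs
  imports "HOL-Probability.Probability" "HOL-Library.Disjoint_Sets"
begin

text \<open>The phase space is the whole type; a free type variable ranges over all nonempty
  metric spaces.\<close>

definition dynamical_system :: "('a::metric_space \<Rightarrow> 'a) \<Rightarrow> bool" where
  "dynamical_system T \<longleftrightarrow> compact (UNIV :: 'a set) \<and> continuous_on UNIV T"

definition transitive_system :: "('a::topological_space \<Rightarrow> 'a) \<Rightarrow> bool" where
  "transitive_system T \<longleftrightarrow>
     (\<forall>U V. open U \<and> open V \<and> U \<noteq> {} \<and> V \<noteq> {} \<longrightarrow> (\<exists>n>0. (T ^^ n) ` U \<inter> V \<noteq> {}))"

definition pseudo_orbit :: "('a::metric_space \<Rightarrow> 'a) \<Rightarrow> real \<Rightarrow> (nat \<Rightarrow> 'a) \<Rightarrow> bool" where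
  "pseudo_orbit T \<delta> x \<longleftrightarrow> (\<forall>n. dist (T (x n)) (x (Suc n)) < \<delta>)"

definition traced_by :: "('a::metric_space \<Rightarrow> 'a) \<Rightarrow> real \<Rightarrow> (nat \<Rightarrow> 'a) \<Rightarrow> 'a \<Rightarrow> bool" where
  "traced_by T \<epsilon> x y \<longleftrightarrow> (\<forall>n. dist ((T ^^ n) y) (x n) < \<epsilon>)"

definition shadowing_property :: "('a::metric_space \<Rightarrow> 'a) \<Rightarrow> bool" where
  "shadowing_property T \<longleftrightarrow>
     (\<forall>\<epsilon>>0. \<exists>\<delta>>0. \<forall>x. pseudo_orbit T \<delta> x \<longrightarrow> (\<exists>y. traced_by T \<epsilon> x y))"

definition invariant_measures :: "('a::topological_space \<Rightarrow> 'a) \<Rightarrow> 'a measure set" where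
  "invariant_measures T = {\<mu>. prob_space \<mu> \<and> sets \<mu> = sets borel \<and> distr \<mu> borel T = \<mu>}"

text \<open>The coarsest topology on the invariant measures for which integration of every continuous
  real function is continuous. Boundedness of the test functions is automatic when the phase
  space is compact.\<close>

definition invariant_measure_topology ::
    "('a::topological_space \<Rightarrow> 'a) \<Rightarrow> 'a measure topology" where
  "invariant_measure_topology T = topology_generated_by
     {{\<mu> \<in> invariant_measures T. (\<integral>x. f x \<partial>\<mu>) \<in> U} | (f :: 'a \<Rightarrow> real) U.
        continuous_on UNIV f \<and> open U}"

lemma topspace_invariant_measure_topology [simp]:
  "topspace (invariant_measure_topology T) = invariant_measures T"
proof -
  have "continuous_on UNIV (\<lambda>x::'a. 0::real) \<and> open (UNIV::real set)"
    by simp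
  then show ?thesis
    unfolding invariant_measure_topology_def topology_generated_by_topspace by blast
qed

definition finite_measurable_partition :: "'a measure \<Rightarrow> 'a set set \<Rightarrow> bool" where
  "finite_measurable_partition \<mu> P \<longleftrightarrow> finite P \<and> P \<subseteq> sets \<mu> \<and> partition_on (space \<mu>) P"

text \<open>Since \<^term>\<open>ln 0 = (0::real)\<close>, the convention that $0 \log 0 = 0$ is built in.\<close>

definition partition_entropy :: "'a measure \<Rightarrow> 'a set set \<Rightarrow> real" where
  "partition_entropy \<mu> P = - (\<Sum>A\<in>P. measure \<mu> A * ln (measure \<mu> A))"

text \<open>The join of the partitions $T^{-i} P$ for $i < n$. Empty preimages may occur here, but
  \<^const>\<open>common_refinement\<close> discards empty cells.\<close>

definition dynamical_refinement :: "('a \<Rightarrow> 'a) \<Rightarrow> 'a set set \<Rightarrow> nat \<Rightarrow> 'a set set" where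
  "dynamical_refinement T P n = common_refinement ((\<lambda>i. (\<lambda>A. (T ^^ i) -` A) ` P) ` {..<n})"

definition partition_entropy_rate :: "'a measure \<Rightarrow> ('a \<Rightarrow> 'a) \<Rightarrow> 'a set set \<Rightarrow> real" where
  "partition_entropy_rate \<mu> T P =
     lim (\<lambda>n. partition_entropy \<mu> (dynamical_refinement T P n) / real n)"

definition measure_entropy :: "'a measure \<Rightarrow> ('a \<Rightarrow> 'a) \<Rightarrow> ennreal" where
  "measure_entropy \<mu> T =
     (SUP P \<in> {P. finite_measurable_partition \<mu> P}. ennreal (partition_entropy_rate \<mu> T P))"

definition dense_in :: "'a topology \<Rightarrow> 'a set \<Rightarrow> bool" where
  "dense_in X S \<longleftrightarrow> S \<subseteq> topspace X \<and> X closure_of S = topspace X"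

definition nowhere_dense_in :: "'a topology \<Rightarrow> 'a set \<Rightarrow> bool" where
  "nowhere_dense_in X S \<longleftrightarrow> S \<subseteq> topspace X \<and> X interior_of (X closure_of S) = {}"

definition first_category_in :: "'a topology \<Rightarrow> 'a set \<Rightarrow> bool" where
  "first_category_in X S \<longleftrightarrow>
     (\<exists>\<N>. countable \<N> \<and> (\<forall>N\<in>\<N>. nowhere_dense_in X N) \<and> S = \<Union>\<N>)"

definition residual_in :: "'a topology \<Rightarrow> 'a set \<Rightarrow> bool" where
  "residual_in X S \<longleftrightarrow> S \<subseteq> topspace X \<and> first_category_in X (topspace X - S)"

definition upper_semicontinuous_map :: "'a topology \<Rightarrow> ('a \<Rightarrow> 'b::linorder) \<Rightarrow> bool" where
  "upper_semicontinuous_map X f \<longleftrightarrow> (\<forall>a. openin X {x \<in> topspace X. f x < a})"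

end

theory Submission
  imports Defs "HOL-Real_Asymp.Real_Asymp"
begin

text \<open>An invariant measure has the same integral against a test function as against its orbit averages
  of any length, so it is close to a uniform average of long orbit segments. Transitivity joins these
  segments, at bounded cost, to a periodic pseudo-orbit. Shadowing it and closing up the shadowing
  orbit again and again, with summable errors, yields in the limit an orbit that is almost periodic
  uniformly in time, with periods \<open>q k\<close> dividing one another. Its closure is a factor of an odometer,
  and the image \<open>\<nu>\<close> of Haar measure is an invariant measure whose integrals are the orbit
  averages. The iterates \<open>T ^^ q k\<close> converge to the identity uniformly on the support of \<open>\<nu>\<close>, so
  \<open>\<nu>\<close> is rigid, and a rigid measure has zero entropy: in the itinerary of a point with respect to a
  partition, each letter is almost determined by the one \<open>q k\<close> steps before.

  If the entropy is upper semicontinuous, the measures of entropy at least \<open>1 / n\<close> form a closed set,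
  which has empty interior by density.\<close>

section \<open>Entropy of finite-valued maps\<close>

text \<open>A point that shadows a periodic pseudo-orbit need not be periodic, since shadowing gives
  no uniqueness, so measures on periodic orbits are not at hand. What survives is recurrence:
  watched at the multiples of the period, the shadowing orbit comes close to itself by compactness,
  and cutting it there gives a finer pseudo-orbit whose period is a multiple of the old one. This
  divisibility serves twice. It makes the residues modulo \<open>q k\<close> consistent, as an
  odometer requires, and it makes the orbit averages over \<open>q k\<close> steps run over whole
  periods of the first pseudo-orbit, so that the limit measure inherits its averages up to the
  tracing error.

  The given measure may be far from ergodic, so one long orbit segment would not represent it; the
  segments start at a finite sample of points, chosen to get finitely many integrals right at once.

  Partitions are replaced by maps that label their cells: joins become pairs or words, and preimages
  of partitions become compositions.\<close>

definition map_entropy :: "'a measure \<Rightarrow> ('a \<Rightarrow> 'b) \<Rightarrow> real" where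
  "map_entropy M f = - (\<Sum>v\<in>range f. measure M (f -` {v}) * ln (measure M (f -` {v})))"

text \<open>A missed value has an empty fibre and contributes \<open>0 * ln 0 = 0\<close>. All maps
  into one finite set thus share an index set, and a limit of their entropies can be taken
  termwise.\<close>

lemma map_entropy_superset:
  assumes "finite S" "range f \<subseteq> S"
  shows "map_entropy M f = - (\<Sum>v\<in>S. measure M (f -` {v}) * ln (measure M (f -` {v})))"
proof -
  have "f -` {v} = {}" if "v \<in> S - range f" for v
    using that by auto
  then show ?thesis
    unfolding map_entropy_def using assms by (intro arg_cong[of _ _ uminus] sum.mono_neutral_left) auto
qed

text \<open>Grouping the fibres of \<open>W\<close> by the value of \<open>\<phi>\<close> turns the
  entropy of a coarser map into a sum over the values of \<open>W\<close>. Several coarsenings of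
  one \<open>W\<close> can then be compared term by term, with the same weights.\<close>

lemma map_entropy_comp:
  assumes "prob_space M" "finite (range W)" "\<And>w. W -` {w} \<in> sets M"
  shows "map_entropy M (\<lambda>x. \<phi> (W x)) =
    - (\<Sum>w\<in>range W. measure M (W -` {w}) * ln (measure M ((\<lambda>x. \<phi> (W x)) -` {\<phi> w})))"
proof -
  interpret prob_space M by fact
  have fin: "finite (range (\<lambda>x. \<phi> (W x)))"
    using finite_imageI[OF assms(2), of \<phi>] by (simp add: image_image)
  have meas: "measure M ((\<lambda>x. \<phi> (W x)) -` {v}) = (\<Sum>w\<in>{w\<in>range W. \<phi> w = v}. measure M (W -` {w}))" for v
  proof -
    have "(\<lambda>x. \<phi> (W x)) -` {v} = (\<Union>w\<in>{w\<in>range W. \<phi> w = v}. W -` {w})"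
      by auto
    then show ?thesis
      using assms by (simp, intro finite_measure_finite_Union) (auto simp: disjoint_family_on_def)
  qed
  let ?g = "\<lambda>w. measure M (W -` {w}) * ln (measure M ((\<lambda>x. \<phi> (W x)) -` {\<phi> w}))"
  have "(\<Sum>w\<in>range W. ?g w) = (\<Sum>v\<in>range (\<lambda>x. \<phi> (W x)). \<Sum>w\<in>{w\<in>range W. \<phi> w = v}. ?g w)"
    by (rule sum.group[symmetric]) (use assms fin in auto)
  also have "\<dots> = (\<Sum>v\<in>range (\<lambda>x. \<phi> (W x)). measure M ((\<lambda>x. \<phi> (W x)) -` {v}) * ln (measure M ((\<lambda>x. \<phi> (W x)) -` {v})))"
    by (rule sum.cong) (auto simp: meas sum_distrib_right)
  finally show ?thesis
    unfolding map_entropy_def by simp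
qed

text \<open>This is \<open>ln x \<le> x - 1\<close> at x = ab/(pc), the pointwise form of the
  nonnegativity of conditional mutual information. Since p lies below the other three, a vanishing
  denominator or argument of \<open>ln\<close> forces p = 0.\<close>

lemma mult_ln_quotient_le:
  fixes p a b c :: real
  assumes "0 \<le> p" "p \<le> a" "p \<le> b" "p \<le> c"
  shows "p * (ln a + ln b - ln p - ln c) \<le> a * b / c - p"
proof (cases "p = 0")
  case True
  then show ?thesis using assms by simp
next
  case False
  then have pos: "0 < p" "0 < a" "0 < b" "0 < c" using assms by auto
  then have "ln a + ln b - ln p - ln c = ln (a * b / (p * c))"
    by (simp add: ln_mult ln_div)
  also have "\<dots> \<le> a * b / (p * c) - 1"
    using pos by (intro ln_le_minus_one) simp
  finally have "p * (ln a + ln b - ln p - ln c) \<le> p * (a * b / (p * c) - 1)"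
    using pos by (intro mult_left_mono) auto
  also have "\<dots> = a * b / c - p"
    using pos by (simp add: field_simps)
  finally show ?thesis .
qed

text \<open>In terms of conditional entropy: \<open>H (Z | X) \<le> H (Z | g \<circ> X)\<close>.\<close>

lemma map_entropy_strong_subadditive:
  assumes "prob_space M"
    and X: "finite (range X)" "\<And>v. X -` {v} \<in> sets M"
    and Z: "finite (range Z)" "\<And>v. Z -` {v} \<in> sets M"
  shows "map_entropy M (\<lambda>x. (X x, Z x)) + map_entropy M (\<lambda>x. g (X x))
    \<le> map_entropy M X + map_entropy M (\<lambda>x. (g (X x), Z x))"
proof -
  interpret prob_space M by fact
  define W where "W = (\<lambda>x. (X x, Z x))"
  have sub: "range W \<subseteq> range X \<times> range Z" by (auto simp: W_def)
  then have Wfin: "finite (range W)" using X Z finite_subset by blast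
  have Wvim: "W -` {w} = X -` {fst w} \<inter> Z -` {snd w}" for w by (cases w) (auto simp: W_def)
  have Wm: "W -` {w} \<in> sets M" for w unfolding Wvim using X Z by blast
  have gvim: "(\<lambda>x. g (X x)) -` {v} = (\<Union>u\<in>{u\<in>range X. g u = v}. X -` {u})" for v by auto
  have gm: "(\<lambda>x. g (X x)) -` {v} \<in> sets M" for v
    unfolding gvim using X by (intro sets.finite_UN) auto
  note comp = map_entropy_comp[OF assms(1) Wfin Wm]
  \<comment> \<open>With Y = g \<circ> X, these four are the distributions of (X, Z), X, (Y, Z) and
    Y, in this order.\<close>
  define p where "p = (\<lambda>w. measure M (W -` {w}))"
  define a where "a = (\<lambda>u. measure M (X -` {u}))"
  define b where "b = (\<lambda>y z. measure M ((\<lambda>x. g (X x)) -` {y} \<inter> Z -` {z}))"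
  define c where "c = (\<lambda>y. measure M ((\<lambda>x. g (X x)) -` {y}))"
  have b_alt: "(\<lambda>x. (g (X x), Z x)) -` {(y, z)} = (\<lambda>x. g (X x)) -` {y} \<inter> Z -` {z}" for y z by auto
  have E1: "map_entropy M (\<lambda>x. (X x, Z x)) = - (\<Sum>w\<in>range W. p w * ln (p w))"
    unfolding map_entropy_def p_def W_def ..
  have E2: "map_entropy M X = - (\<Sum>w\<in>range W. p w * ln (a (fst w)))"
    using comp[of fst] by (simp add: p_def a_def W_def)
  have E3: "map_entropy M (\<lambda>x. g (X x)) = - (\<Sum>w\<in>range W. p w * ln (c (g (fst w))))"
    using comp[of "\<lambda>w. g (fst w)"] by (simp add: p_def c_def W_def)
  have E4: "map_entropy M (\<lambda>x. (g (X x), Z x)) = - (\<Sum>w\<in>range W. p w * ln (b (g (fst w)) (snd w)))"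
    using comp[of "\<lambda>w. (g (fst w), snd w)"] by (simp add: p_def b_def W_def b_alt)
  have le: "p w * (ln (a (fst w)) + ln (b (g (fst w)) (snd w)) - ln (p w) - ln (c (g (fst w))))
      \<le> a (fst w) * b (g (fst w)) (snd w) / c (g (fst w)) - p w" for w
  proof (rule mult_ln_quotient_le)
    show "p w \<le> a (fst w)" "p w \<le> b (g (fst w)) (snd w)" "p w \<le> c (g (fst w))"
      unfolding p_def a_def b_def c_def Wvim using X Z gm by (intro finite_measure_mono; force)+
  qed (simp add: p_def)
  have "(\<Union>v\<in>range X. X -` {v}) \<in> sets M" using X by (intro sets.finite_UN) auto
  moreover have "(\<Union>v\<in>range X. X -` {v}) = UNIV" by auto
  ultimately have "space M = UNIV" using sets.sets_into_space by auto
  then have prob_UNIV: "measure M UNIV = 1" using prob_space by simp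
  have sum_p: "(\<Sum>w\<in>range W. p w) = 1"
  proof -
    have "(\<Sum>w\<in>range W. p w) = measure M (\<Union>w\<in>range W. W -` {w})"
      unfolding p_def using Wfin Wm
      by (intro finite_measure_finite_Union[symmetric]) (auto simp: disjoint_family_on_def)
    also have "(\<Union>w\<in>range W. W -` {w}) = UNIV" by auto
    finally show ?thesis using prob_UNIV by simp
  qed
  have sum_a: "(\<Sum>u\<in>range X. a u) = 1"
  proof -
    have "(\<Sum>u\<in>range X. a u) = measure M (\<Union>u\<in>range X. X -` {u})"
      unfolding a_def using X
      by (intro finite_measure_finite_Union[symmetric]) (auto simp: disjoint_family_on_def)
    also have "(\<Union>u\<in>range X. X -` {u}) = UNIV" by auto
    finally show ?thesis using prob_UNIV by simp
  qed
  have sum_b: "(\<Sum>z\<in>range Z. b y z) = c y" for y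
  proof -
    have "(\<Sum>z\<in>range Z. b y z) = measure M (\<Union>z\<in>range Z. (\<lambda>x. g (X x)) -` {y} \<inter> Z -` {z})"
      unfolding b_def using Z gm
      by (intro finite_measure_finite_Union[symmetric]) (auto simp: disjoint_family_on_def)
    also have "(\<Union>z\<in>range Z. (\<lambda>x. g (X x)) -` {y} \<inter> Z -` {z}) = (\<lambda>x. g (X x)) -` {y}" by auto
    finally show ?thesis by (simp add: c_def)
  qed
  have nn: "0 \<le> a u" "0 \<le> b y z" "0 \<le> c y" for u y z by (simp_all add: a_def b_def c_def)
  \<comment> \<open>Extending the sum from the attained pairs to the whole product lets the sum over
    z be carried out, which turns b into c and cancels the denominator.\<close>
  have "(\<Sum>w\<in>range W. a (fst w) * b (g (fst w)) (snd w) / c (g (fst w)))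
     \<le> (\<Sum>w\<in>range X \<times> range Z. a (fst w) * b (g (fst w)) (snd w) / c (g (fst w)))"
    using X Z sub nn by (intro sum_mono2) auto
  also have "\<dots> = (\<Sum>u\<in>range X. a u * (\<Sum>z\<in>range Z. b (g u) z) / c (g u))"
    by (simp add: sum.cartesian_product' sum_distrib_left sum_divide_distrib)
  also have "\<dots> \<le> (\<Sum>u\<in>range X. a u)"
    unfolding sum_b using nn by (intro sum_mono) (auto simp: divide_simps)
  finally have "(\<Sum>w\<in>range W. a (fst w) * b (g (fst w)) (snd w) / c (g (fst w))) \<le> 1"
    using sum_a by simp
  moreover have "(\<Sum>w\<in>range W. p w * (ln (a (fst w)) + ln (b (g (fst w)) (snd w)) - ln (p w) - ln (c (g (fst w)))))
      \<le> (\<Sum>w\<in>range W. a (fst w) * b (g (fst w)) (snd w) / c (g (fst w)) - p w)"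
    by (intro sum_mono le)
  ultimately have "(\<Sum>w\<in>range W. p w * (ln (a (fst w)) + ln (b (g (fst w)) (snd w)) - ln (p w) - ln (c (g (fst w))))) \<le> 0"
    using sum_p by (simp add: sum_subtractf)
  then show ?thesis
    unfolding E1 E2 E3 E4 by (simp add: sum_subtractf sum.distrib algebra_simps)
qed

lemma map_entropy_nonneg:
  assumes "prob_space M"
  shows "0 \<le> map_entropy M f"
proof -
  interpret prob_space M by fact
  have "measure M A * ln (measure M A) \<le> 0" for A
    by (cases "measure M A = 0") (auto intro!: mult_nonneg_nonpos simp: zero_less_measure_iff less_le)
  then show ?thesis
    unfolding map_entropy_def by (simp add: sum_nonpos)
qed

lemma map_entropy_comp_inj_on:
  assumes "inj_on \<phi> (range f)"
  shows "map_entropy M (\<lambda>x. \<phi> (f x)) = map_entropy M f"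
proof -
  have "range (\<lambda>x. \<phi> (f x)) = \<phi> ` range f" by auto
  moreover have "(\<lambda>x. \<phi> (f x)) -` {\<phi> v} = f -` {v}" if "v \<in> range f" for v
    using assms that by (auto dest: inj_onD)
  ultimately show ?thesis
    unfolding map_entropy_def using assms by (simp add: sum.reindex)
qed

text \<open>The function \<open>x * ln x\<close> is continuous on the closed half-line: its
  one-sided limit at 0 is 0, which is also the value of \<open>0 * ln 0\<close>. Nonnegativity keeps
  the sequence inside the half-line.\<close>

lemma tendsto_mult_ln:
  fixes a :: "nat \<Rightarrow> real"
  assumes "a \<longlonglongrightarrow> l" "\<And>n. 0 \<le> a n"
  shows "(\<lambda>n. a n * ln (a n)) \<longlonglongrightarrow> l * ln l"
proof (cases "l = 0")
  case True
  have "((\<lambda>x::real. x * ln x) \<longlongrightarrow> 0) (at_right 0)" by real_asymp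
  then have "((\<lambda>x::real. x * ln x) \<longlongrightarrow> 0 * ln 0) (at 0 within {0..})"
    by (simp add: at_within_Ici_at_right)
  then have "continuous (at 0 within {0..}) (\<lambda>x::real. x * ln x)"
    by (simp add: continuous_within)
  from continuous_within_tendsto_compose[OF this _ assms(1)[unfolded True]]
  show ?thesis using assms True by simp
next
  case False
  with assms show ?thesis by (intro tendsto_intros) auto
qed

section \<open>Rigid measures have zero entropy\<close>

lemma map_entropy_invariant:
  assumes "distr M borel S = M" "S \<in> measurable M borel"
    and f: "finite (range f)" "\<And>v. f -` {v} \<in> sets borel" and "space M = UNIV"
  shows "map_entropy M (\<lambda>x. f (S x)) = map_entropy M f"
proof -
  have "measure M ((\<lambda>x. f (S x)) -` {v}) = measure M (f -` {v})" for v
  proof -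
    have "measure M (f -` {v}) = measure (distr M borel S) (f -` {v})" using assms by simp
    also have "\<dots> = measure M (S -` (f -` {v}))"
      by (subst measure_distr) (use assms in auto)
    finally show ?thesis by (simp add: vimage_def)
  qed
  moreover have sub: "range (\<lambda>x. f (S x)) \<subseteq> range f" by auto
  ultimately show ?thesis
    unfolding map_entropy_superset[OF f(1) sub] map_entropy_superset[OF f(1) order_refl] by simp
qed

lemma distr_funpow:
  assumes "distr M borel T = M" "T \<in> measurable borel borel" "sets M = sets borel"
  shows "distr M borel (T ^^ n) = M" "T ^^ n \<in> measurable borel borel"
proof -
  show m: "T ^^ n \<in> measurable borel borel" for n
    by (induction n) (use assms in auto)
  show "distr M borel (T ^^ n) = M"
  proof (induction n)
    case 0
    show ?case using assms(3) by (simp add: distr_id2 id_def)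
  next
    case (Suc n)
    have mm: "measurable M borel = measurable borel borel"
      using assms(3) by (rule measurable_cong_sets) simp
    have "distr M borel (T ^^ Suc n) = distr (distr M borel (T ^^ n)) borel T"
      using assms m mm by (subst distr_distr) (auto simp: comp_def)
    then show ?case using Suc assms by (simp add: comp_def)
  qed
qed

definition cell :: "'a set set \<Rightarrow> 'a \<Rightarrow> 'a set" where
  "cell P x = (THE A. A \<in> P \<and> x \<in> A)"

definition itinerary :: "('a \<Rightarrow> 'a) \<Rightarrow> 'a set set \<Rightarrow> nat \<Rightarrow> 'a \<Rightarrow> 'a set list" where
  "itinerary T P n x = map (\<lambda>i. cell P ((T ^^ i) x)) [0..<n]"

lemma cell_in_partition:
  assumes "partition_on UNIV P"
  shows "cell P x \<in> P" "A \<in> P \<Longrightarrow> cell P x = A \<longleftrightarrow> x \<in> A"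
proof -
  have "\<exists>!A. A \<in> P \<and> x \<in> A"
    using assms unfolding partition_on_def disjoint_def by blast
  then have *: "cell P x \<in> P \<and> x \<in> cell P x" unfolding cell_def by (rule theI')
  then show "cell P x \<in> P" by simp
  show "cell P x = A \<longleftrightarrow> x \<in> A" if "A \<in> P"
    using * that assms unfolding partition_on_def disjoint_def by blast
qed

lemma cell_vimage:
  assumes "partition_on UNIV P"
  shows "cell P -` {A} = (if A \<in> P then A else {})"
  using cell_in_partition[OF assms] by auto

lemma itinerary_eq_iff:
  "itinerary T P n x = itinerary T P n y \<longleftrightarrow> (\<forall>i<n. cell P ((T ^^ i) x) = cell P ((T ^^ i) y))"
  by (auto simp: itinerary_def)

text \<open>A nonempty intersection of sets chosen from the preimage partitions is determined by any
  of its points x, because each chosen set must be the one that contains x. So it consists of the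
  points that share the itinerary of x.\<close>

lemma dynamical_refinement_eq:
  assumes P: "partition_on UNIV P"
  shows "dynamical_refinement T P n = (\<lambda>v. itinerary T P n -` {v}) ` range (itinerary T P n)"
proof -
  define Q where "Q = (\<lambda>i. (\<lambda>A. (T ^^ i) -` A) ` P)"
  have dr: "dynamical_refinement T P n = (\<Union>f \<in> (\<Pi> R\<in>Q ` {..<n}. R). {\<Inter> (f ` Q ` {..<n})}) - {{}}"
    unfolding dynamical_refinement_def common_refinement Q_def ..
  have key: "\<Inter> (f ` Q ` {..<n}) = itinerary T P n -` {itinerary T P n x}"
    if f: "f \<in> (\<Pi> R\<in>Q ` {..<n}. R)" and x: "x \<in> \<Inter> (f ` Q ` {..<n})" for f x
  proof -
    \<comment> \<open>The choice \<open>f\<close> depends on the family \<open>Q i\<close> and not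
      on the index i. This is consistent: a family that occurs for several indices has only one
      member containing x.\<close>
    have fi: "f (Q i) = {y. cell P ((T ^^ i) y) = cell P ((T ^^ i) x)}" if "i < n" for i
    proof -
      have "f (Q i) \<in> Q i" using f that by blast
      then obtain A where A: "A \<in> P" "f (Q i) = (T ^^ i) -` A" unfolding Q_def by blast
      then have "(T ^^ i) x \<in> A" using x that by blast
      then have x_cell: "cell P ((T ^^ i) x) = A" using cell_in_partition(2)[OF P A(1)] by simp
      have "f (Q i) = {y. (T ^^ i) y \<in> A}" unfolding A(2) by (simp add: vimage_def)
      also have "\<dots> = {y. cell P ((T ^^ i) y) = A}"
        by (simp only: cell_in_partition(2)[OF P A(1)])
      finally show ?thesis unfolding x_cell .
    qed
    have "y \<in> \<Inter> (f ` Q ` {..<n}) \<longleftrightarrow> (\<forall>i<n. y \<in> f (Q i))" for y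
      by blast
    then show ?thesis
      using fi by (simp add: set_eq_iff itinerary_eq_iff)
  qed
  show ?thesis
  proof (intro equalityI subsetI)
    fix X assume "X \<in> dynamical_refinement T P n"
    then obtain f where f: "f \<in> (\<Pi> R\<in>Q ` {..<n}. R)" "X = \<Inter> (f ` Q ` {..<n})" "X \<noteq> {}"
      unfolding dr by blast
    then obtain x where "x \<in> X" by blast
    with key[OF f(1), of x] f show "X \<in> (\<lambda>v. itinerary T P n -` {v}) ` range (itinerary T P n)"
      by blast
  next
    fix X assume "X \<in> (\<lambda>v. itinerary T P n -` {v}) ` range (itinerary T P n)"
    then obtain x where x: "X = itinerary T P n -` {itinerary T P n x}" by blast
    have ex: "\<exists>B. B \<in> R \<and> x \<in> B" if "R \<in> Q ` {..<n}" for R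
    proof -
      obtain i where i: "R = Q i" using \<open>R \<in> _\<close> by blast
      have "(T ^^ i) x \<in> cell P ((T ^^ i) x)" "cell P ((T ^^ i) x) \<in> P"
        using cell_in_partition[OF P] by blast+
      with i show ?thesis unfolding Q_def by blast
    qed
    define f where "f R = (SOME B. B \<in> R \<and> x \<in> B)" for R
    have f: "f R \<in> R \<and> x \<in> f R" if "R \<in> Q ` {..<n}" for R
      unfolding f_def using someI_ex[OF ex[OF that]] .
    have "X = \<Inter> (f ` Q ` {..<n})"
      using key[of f x] f x by blast
    moreover have "X \<noteq> {}" using x by blast
    ultimately show "X \<in> dynamical_refinement T P n"
      unfolding dr using f by blast
  qed
qed

lemma partition_entropy_dynamical_refinement:
  assumes "partition_on UNIV P"
  shows "partition_entropy M (dynamical_refinement T P n) = map_entropy M (itinerary T P n)"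
proof -
  have "inj_on (\<lambda>v. itinerary T P n -` {v}) (range (itinerary T P n))"
    by (rule inj_onI) blast
  then show ?thesis
    unfolding partition_entropy_def map_entropy_def dynamical_refinement_eq[OF assms]
    by (simp add: sum.reindex)
qed

lemma itinerary_finite_measurable:
  fixes T :: "'a::metric_space \<Rightarrow> 'a"
  assumes P: "partition_on UNIV P" "finite P" "P \<subseteq> sets borel" and T: "T \<in> measurable borel borel"
  shows "finite (range (itinerary T P n))" "itinerary T P n -` {v} \<in> sets borel"
proof -
  have "range (itinerary T P n) \<subseteq> {w. set w \<subseteq> P \<and> length w = n}"
    using cell_in_partition(1)[OF P(1)] by (auto simp: itinerary_def)
  then show "finite (range (itinerary T P n))"
    using finite_lists_length_eq[OF P(2)] finite_subset by blast
  have m: "T ^^ n \<in> measurable borel borel" for n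
    by (induction n) (use T in auto)
  show "itinerary T P n -` {v} \<in> sets borel"
  proof (cases "length v = n")
    case True
    then have "itinerary T P n -` {v} = {x \<in> space borel. \<forall>i\<in>{..<n}. x \<in> (T ^^ i) -` (cell P -` {v ! i})}"
      by (intro set_eqI) (auto simp: itinerary_def list_eq_iff_nth_eq)
    also have "\<dots> \<in> sets borel"
    proof (rule sets.sets_Collect_finite_All)
      fix i
      have "cell P -` {v ! i} \<in> sets borel" using P cell_vimage[OF P(1)] by auto
      from measurable_sets[OF m this, of i] show "{x \<in> space borel. x \<in> (T ^^ i) -` (cell P -` {v ! i})} \<in> sets borel"
        by (simp add: vimage_def)
    qed simp
    finally show ?thesis .
  next
    case False
    then have "itinerary T P n -` {v} = {}" by (auto simp: itinerary_def)
    then show ?thesis by simp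
  qed
qed

text \<open>The new letter costs its entropy given the first n letters, which is at most its entropy
  given the single letter p steps earlier; by invariance, this pair of letters is distributed like
  those at times 0 and p. The bounds on p place position \<open>n - p\<close> inside the
  word.\<close>

lemma map_entropy_itinerary_Suc_le:
  fixes T :: "'a::metric_space \<Rightarrow> 'a"
  assumes M: "prob_space M" "sets M = sets borel" "distr M borel T = M"
    and T: "T \<in> measurable borel borel"
    and P: "partition_on UNIV P" "finite P" "P \<subseteq> sets borel"
    and p: "0 < p" "p \<le> n"
  shows "map_entropy M (itinerary T P (Suc n)) \<le> map_entropy M (itinerary T P n) +
    (map_entropy M (\<lambda>x. (cell P x, cell P ((T ^^ p) x))) - map_entropy M (cell P))"
proof -
  let ?Z = "\<lambda>k x. cell P ((T ^^ k) x)"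
  have sp: "space M = UNIV" using sets_eq_imp_space_eq[OF M(2)] by simp
  note D = distr_funpow[OF M(3) T M(2)]
  have Zfin: "finite (range (?Z k))" for k
    using P(2) cell_in_partition(1)[OF P(1)] by (auto intro: finite_subset[of _ P])
  have cm: "cell P -` {v} \<in> sets borel" for v
    using P cell_vimage[OF P(1)] by auto
  have Zm: "?Z k -` {v} \<in> sets borel" for k v
    using measurable_sets[OF D(2)[of k] cm[of v]] by (simp add: vimage_def)
  have "map_entropy M (\<lambda>x. (itinerary T P n x, ?Z n x)) + map_entropy M (\<lambda>x. itinerary T P n x ! (n - p))
    \<le> map_entropy M (itinerary T P n) + map_entropy M (\<lambda>x. (itinerary T P n x ! (n - p), ?Z n x))"
    using itinerary_finite_measurable[OF P T] Zfin[of n] Zm[of n] M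
    by (intro map_entropy_strong_subadditive) auto
  moreover have "map_entropy M (\<lambda>x. (itinerary T P n x, ?Z n x)) = map_entropy M (itinerary T P (Suc n))"
  proof -
    have "inj_on (\<lambda>(w, a). w @ [a]) (range (\<lambda>x. (itinerary T P n x, ?Z n x)))"
      by (auto intro!: inj_onI)
    from map_entropy_comp_inj_on[OF this, of M] show ?thesis by (simp add: itinerary_def[abs_def])
  qed
  moreover have idx: "itinerary T P n x ! (n - p) = ?Z (n - p) x" for x
    using p by (simp add: itinerary_def)
  moreover have "map_entropy M (\<lambda>x. ?Z (n - p) x) = map_entropy M (cell P)"
    using D[of "n - p"] Zfin[of 0] cm sp M by (intro map_entropy_invariant) (auto cong: measurable_cong_sets)
  moreover have "map_entropy M (\<lambda>x. (?Z (n - p) x, ?Z n x)) = map_entropy M (\<lambda>x. (cell P x, ?Z p x))"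
  proof -
    have "?Z n x = ?Z p ((T ^^ (n - p)) x)" for x
      using p by (metis comp_apply funpow_add le_add_diff_inverse)
    moreover have "finite (range (\<lambda>x. (cell P x, ?Z p x)))"
      by (rule finite_subset[of _ "range (cell P) \<times> range (?Z p)"]) (use Zfin[of 0] Zfin[of p] in auto)
    moreover have "(\<lambda>x. (cell P x, ?Z p x)) -` {v} \<in> sets borel" for v
    proof -
      have "(\<lambda>x. (cell P x, ?Z p x)) -` {v} = cell P -` {fst v} \<inter> ?Z p -` {snd v}"
        by (cases v) auto
      then show ?thesis using cm Zm by (simp add: sets.Int)
    qed
    ultimately show ?thesis
      using map_entropy_invariant[of M "T ^^ (n - p)" "\<lambda>x. (cell P x, ?Z p x)"] D[of "n - p"] sp M
      by (simp cong: measurable_cong_sets)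
  qed
  ultimately show ?thesis by simp
qed

text \<open>Given the letter at time 0, the letter at time \<open>q k\<close> has conditional
  entropy \<open>\<kappa> k\<close>, which tends to 0 because rigidity drives the joint distribution
  of the two letters to the diagonal. From time \<open>q k\<close> on, every further letter costs at
  most \<open>\<kappa> k\<close>, so for each k this bounds the entropy per letter
  asymptotically.\<close>

lemma measure_entropy_eq_0_if_rigid:
  fixes T :: "'a::metric_space \<Rightarrow> 'a"
  assumes M: "prob_space M" "sets M = sets borel" "distr M borel T = M"
    and T: "T \<in> measurable borel borel"
    and q: "\<And>k. 0 < q k"
    and rigid: "\<And>A B. A \<in> sets borel \<Longrightarrow> B \<in> sets borel \<Longrightarrow>
      (\<lambda>k. measure M (A \<inter> (T ^^ q k) -` B)) \<longlonglongrightarrow> measure M (A \<inter> B)"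
  shows "measure_entropy M T = 0"
proof -
  have sp: "space M = UNIV" using sets_eq_imp_space_eq[OF M(2)] by simp
  have "partition_entropy_rate M T P = 0" if "finite_measurable_partition M P" for P
  proof -
    have P: "partition_on UNIV P" "finite P" "P \<subseteq> sets borel"
      using that sp M(2) by (auto simp: finite_measurable_partition_def)
    have cm: "cell P -` {v} \<in> sets borel" for v
      using P cell_vimage[OF P(1)] by auto
    have sub: "range (\<lambda>x. (cell P x, cell P (f x))) \<subseteq> P \<times> P" for f
      using cell_in_partition(1)[OF P(1)] by auto
    have sup: "map_entropy M (\<lambda>x. (cell P x, cell P (f x))) = - (\<Sum>v\<in>P \<times> P.
        measure M ((\<lambda>x. (cell P x, cell P (f x))) -` {v}) *
        ln (measure M ((\<lambda>x. (cell P x, cell P (f x))) -` {v})))" for f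
      by (rule map_entropy_superset[OF finite_cartesian_product[OF P(2) P(2)] sub])
    have vim: "(\<lambda>x. (cell P x, cell P (f x))) -` {v} = cell P -` {fst v} \<inter> f -` (cell P -` {snd v})" for f v
      by (cases v) auto
    define \<kappa> where "\<kappa> k = map_entropy M (\<lambda>x. (cell P x, cell P ((T ^^ q k) x))) - map_entropy M (cell P)" for k
    have "map_entropy M (cell P) = map_entropy M (\<lambda>x. (cell P x, cell P x))"
      by (rule map_entropy_comp_inj_on[symmetric]) (auto intro: inj_onI)
    moreover have "(\<lambda>k. map_entropy M (\<lambda>x. (cell P x, cell P ((T ^^ q k) x))))
        \<longlonglongrightarrow> map_entropy M (\<lambda>x. (cell P x, cell P x))"
      unfolding sup sup[of "\<lambda>x. x"] vim vim[of "\<lambda>x. x"] vimage_ident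
      by (intro tendsto_minus tendsto_sum tendsto_mult_ln) (use rigid[OF cm cm] in auto)
    ultimately have \<kappa>: "\<kappa> \<longlonglongrightarrow> 0"
      unfolding \<kappa>_def using LIM_zero by auto
    define H where "H n = map_entropy M (itinerary T P n)" for n
    have H0: "0 \<le> H n" for n unfolding H_def by (rule map_entropy_nonneg[OF M(1)])
    \<comment> \<open>The entropy rate is a \<open>lim\<close>, whose value is known only once
      convergence is proved, so an upper bound is not enough.\<close>
    have "(\<lambda>n. H n / real n) \<longlonglongrightarrow> 0"
    proof (rule tendstoI)
      fix e :: real assume e: "0 < e"
      obtain k where k: "\<kappa> k < e / 2"
        using order_tendstoD(2)[OF \<kappa>, of "e / 2"] e by (auto simp: eventually_sequentially)
      have step: "H (Suc n) \<le> H n + e / 2" if "q k \<le> n" for n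
        using map_entropy_itinerary_Suc_le[OF M T P q that] k by (simp add: H_def \<kappa>_def)
      \<comment> \<open>The first \<open>q k\<close> letters are paid for by the constant
        \<open>H (q k)\<close>, which disappears after division by n.\<close>
      have bound: "H n \<le> H (q k) + real n * (e / 2)" if "q k \<le> n" for n
        using that
      proof (induction n rule: dec_induct)
        case base
        then show ?case using e by simp
      next
        case (step n)
        then show ?case using \<open>q k \<le> n \<Longrightarrow> H (Suc n) \<le> H n + e / 2\<close> by (simp add: algebra_simps add_divide_distrib)
      qed
      have "(\<lambda>n. H (q k) / real n) \<longlonglongrightarrow> 0" by real_asymp
      then have "\<forall>\<^sub>F n in sequentially. H (q k) / real n < e / 2"
        using e by (intro order_tendstoD(2)) auto
      then show "\<forall>\<^sub>F n in sequentially. dist (H n / real n) 0 < e"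
        using eventually_ge_at_top[of "q k"]
      proof eventually_elim
        case (elim n)
        have n: "0 < n" using elim q[of k] by simp
        have "H n / real n \<le> (H (q k) + real n * (e / 2)) / real n"
          using bound[OF elim(2)] by (simp add: divide_right_mono)
        also have "\<dots> = H (q k) / real n + e / 2" using n by (simp add: field_simps)
        finally have "H n / real n < e" using elim(1) by linarith
        then show ?case using H0[of n] by (simp add: dist_real_def)
      qed
    qed
    then show ?thesis
      unfolding partition_entropy_rate_def partition_entropy_dynamical_refinement[OF P(1)] H_def
      by (rule limI)
  qed
  then have "measure_entropy M T \<le> 0"
    unfolding measure_entropy_def by (intro SUP_least) simp
  then show ?thesis by simp
qed

section \<open>Weak convergence and rigidity\<close>

text \<open>The continuous functions \<open>min 1 (n * infdist x (- U))\<close> have values between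
  0 and 1 and increase to the indicator of the open set U, so the integrals determine the measures
  of open sets. These form an intersection-stable generator of the Borel sets.\<close>

lemma prob_space_eqI_continuous:
  fixes M N :: "'a::metric_space measure"
  assumes M: "prob_space M" "sets M = sets borel" and N: "prob_space N" "sets N = sets borel"
    and eq: "\<And>f::'a \<Rightarrow> real. continuous_on UNIV f \<Longrightarrow> (\<And>x. \<bar>f x\<bar> \<le> 1) \<Longrightarrow> (\<integral>x. f x \<partial>M) = (\<integral>x. f x \<partial>N)"
  shows "M = N"
proof (rule measure_eqI_generator_eq[where E = "{U. open U}" and \<Omega> = UNIV and A = "\<lambda>_. UNIV"])
  have lim: "(\<lambda>n. \<integral>x. min 1 (real n * infdist x (- U)) \<partial>K) \<longlonglongrightarrow> measure K U"
    if U: "open U" "U \<noteq> UNIV" and K: "prob_space K" "sets K = sets borel" for U :: "'a set" and K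
  proof -
    interpret prob_space K by fact
    have meas: "f \<in> borel_measurable K" if "f \<in> borel_measurable borel" for f :: "'a \<Rightarrow> real"
      using that K(2) by (simp cong: measurable_cong_sets)
    have "U \<in> sets K" using U K by simp
    have "(\<lambda>n. \<integral>x. min 1 (real n * infdist x (- U)) \<partial>K) \<longlonglongrightarrow> (\<integral>x. indicator U x \<partial>K)"
    proof (rule integral_dominated_convergence[where w = "\<lambda>_. 1"])
      show "AE x in K. (\<lambda>n. min 1 (real n * infdist x (- U))) \<longlonglongrightarrow> (indicator U x :: real)"
      proof (rule AE_I2)
        fix x
        show "(\<lambda>n. min 1 (real n * infdist x (- U))) \<longlonglongrightarrow> (indicator U x :: real)"
        proof (cases "x \<in> U")
          case True
          then have pos: "0 < infdist x (- U)"
            using U by (intro infdist_pos_not_in_closed) (auto simp: closed_Compl)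
          have "\<forall>\<^sub>F n in sequentially. min 1 (real n * infdist x (- U)) = 1"
          proof -
            obtain m where m: "1 / infdist x (- U) < real m" using reals_Archimedean2 by blast
            have "min 1 (real n * infdist x (- U)) = 1" if "m \<le> n" for n
            proof -
              have "1 / infdist x (- U) < real n" using m that by linarith
              then show ?thesis using pos by (simp add: divide_less_eq)
            qed
            then show ?thesis by (auto simp: eventually_sequentially)
          qed
          then show ?thesis using True by (simp add: tendsto_eventually)
        next
          case False
          then show ?thesis by simp
        qed
      qed
      show "AE x in K. norm (min 1 (real n * infdist x (- U))) \<le> 1" for n
        by (simp add: infdist_nonneg)
      show "(\<lambda>x. min 1 (real n * infdist x (- U))) \<in> borel_measurable K" for n
        by (intro meas borel_measurable_continuous_onI continuous_intros)
    qed (use \<open>U \<in> sets K\<close> in auto)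
    then show ?thesis using \<open>U \<in> sets K\<close> by (simp add: measure_def)
  qed
  interpret M: prob_space M by fact
  interpret N: prob_space N by fact
  have sp: "space M = UNIV" "space N = UNIV"
    using sets_eq_imp_space_eq[OF M(2)] sets_eq_imp_space_eq[OF N(2)] by auto
  show "emeasure M U = emeasure N U" if "U \<in> {U. open U}" for U
  \<comment> \<open>The whole space is treated apart: \<open>infdist x {}\<close> is 0 by
    convention, so the approximating functions would vanish.\<close>
  proof (cases "U = UNIV")
    case True
    then show ?thesis using M.emeasure_space_1 N.emeasure_space_1 sp by simp
  next
    case False
    have "(\<integral>x. min 1 (real n * infdist x (- U)) \<partial>M) = (\<integral>x. min 1 (real n * infdist x (- U)) \<partial>N)" for n
    proof (rule eq)
      fix x
      have "0 \<le> real n * infdist x (- U)" by (simp add: infdist_nonneg)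
      then show "\<bar>min 1 (real n * infdist x (- U))\<bar> \<le> 1" by linarith
    qed (intro continuous_intros)
    with lim[of U M] lim[of U N] that False M N have "measure M U = measure N U"
      by (simp add: LIMSEQ_unique)
    then show ?thesis by (simp add: M.emeasure_eq_measure N.emeasure_eq_measure)
  qed
  show "emeasure M UNIV \<noteq> \<infinity>" by (simp add: M.emeasure_eq_measure)
qed (use M N in \<open>auto simp: Int_stable_def borel_def\<close>)

lemma measure_vimage_funpow:
  assumes M: "sets M = sets borel" "distr M borel T = M" and T: "T \<in> measurable borel borel"
    and B: "B \<in> sets borel"
  shows "(T ^^ n) -` B \<in> sets M" "measure M ((T ^^ n) -` B) = measure M B"
proof -
  note D = distr_funpow[OF M(2) T M(1)]
  have sp: "space M = UNIV" using sets_eq_imp_space_eq[OF M(1)] by simp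
  show "(T ^^ n) -` B \<in> sets M"
    using measurable_sets[OF D(2) B, of n] M(1) by simp
  have "measure M B = measure (distr M borel (T ^^ n)) B" by (simp only: D(1))
  also have "\<dots> = measure M ((T ^^ n) -` B)"
    using D(2)[of n] B M(1) sp by (subst measure_distr) (auto cong: measurable_cong_sets)
  finally show "measure M ((T ^^ n) -` B) = measure M B" by simp
qed

text \<open>As C is closed, the indicators of its neighbourhoods converge pointwise to that of C.
  The radii are not assumed to be monotone, hence dominated convergence in place of continuity from
  above.\<close>

lemma measure_closed_neighbourhood_tendsto:
  fixes M :: "'a::metric_space measure"
  assumes "prob_space M" "sets M = sets borel" and C: "closed C" "C \<noteq> {}"
    and e: "e \<longlonglongrightarrow> 0" "\<And>k. 0 \<le> e k"
  shows "(\<lambda>k. measure M {x. infdist x C \<le> e k}) \<longlonglongrightarrow> measure M C"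
proof -
  interpret prob_space M by fact
  have cl: "{x. infdist x C \<le> e k} \<in> sets M" for k
    unfolding assms(2) by (intro borel_closed closed_Collect_le continuous_intros)
  have C_sets: "C \<in> sets M" unfolding assms(2) using C(1) by (rule borel_closed)
  have "(\<lambda>k. \<integral>x. indicator {x. infdist x C \<le> e k} x \<partial>M) \<longlonglongrightarrow> (\<integral>x. indicator C x \<partial>M :: real)"
  proof (rule integral_dominated_convergence[where w = "\<lambda>_. 1"])
    show "AE x in M. (\<lambda>k. indicator {x. infdist x C \<le> e k} x) \<longlonglongrightarrow> (indicator C x :: real)"
    proof (rule AE_I2)
      fix x
      show "(\<lambda>k. indicator {x. infdist x C \<le> e k} x) \<longlonglongrightarrow> (indicator C x :: real)"
      proof (cases "x \<in> C")
        case True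
        then show ?thesis using e(2) by (simp add: indicator_def)
      next
        case False
        then have "0 < infdist x C" using C by (intro infdist_pos_not_in_closed)
        then have "\<forall>\<^sub>F k in sequentially. e k < infdist x C" by (rule order_tendstoD(2)[OF e(1)])
        then have "\<forall>\<^sub>F k in sequentially. indicator {x. infdist x C \<le> e k} x = (0::real)"
          by eventually_elim (simp add: indicator_def)
        then show ?thesis using False by (simp add: tendsto_eventually)
      qed
    qed
  qed (use C_sets cl in auto)
  then show ?thesis using C_sets cl by simp
qed

text \<open>If the iterate moves x by at most \<open>e k\<close> into a closed set C, then x lies in
  the \<open>e k\<close>-neighbourhood of C, which is hardly larger than C in measure. So C and its
  preimage almost coincide, which settles closed B; the class of good B is closed under complements
  and countable disjoint unions.\<close>

lemma rigid_if_tendsto_id: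
  fixes T :: "'a::metric_space \<Rightarrow> 'a"
  assumes M: "prob_space M" "sets M = sets borel" "distr M borel T = M"
    and T: "T \<in> measurable borel borel"
    and e: "e \<longlonglongrightarrow> 0" "\<And>k. AE x in M. dist ((T ^^ q k) x) x \<le> e k"
    and A: "A \<in> sets borel" and B: "B \<in> sets borel"
  shows "(\<lambda>k. measure M (A \<inter> (T ^^ q k) -` B)) \<longlonglongrightarrow> measure M (A \<inter> B)"
proof -
  interpret prob_space M by fact
  note V = measure_vimage_funpow[OF M(2,3) T]
  have sp: "space M = UNIV" using sets_eq_imp_space_eq[OF M(2)] by simp
  have e0: "0 \<le> e k" for k
  proof -
    have "AE x in M. 0 \<le> e k" using e(2)[of k] by eventually_elim (meson order_trans zero_le_dist)
    then show ?thesis using emeasure_space_1 by simp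
  qed
  have "Int_stable (Collect (closed :: 'a set \<Rightarrow> bool))" "Collect (closed :: 'a set \<Rightarrow> bool) \<subseteq> Pow UNIV"
    by (auto simp: Int_stable_def)
  moreover have "B \<in> sigma_sets UNIV (Collect closed)" using B by (simp add: borel_eq_closed)
  ultimately show ?thesis
  proof (induction B rule: sigma_sets_induct_disjoint)
    case (basic C)
    then have C: "closed C" "C \<in> sets M" "C \<in> sets borel" using M(2) by (auto simp: borel_closed)
    show ?case
    proof (cases "C = {}")
      case True
      then show ?thesis by simp
    next
      case False
      define r where "r k = measure M {x. infdist x C \<le> e k} - measure M C" for k
      have r: "r \<longlonglongrightarrow> 0"
        unfolding r_def using measure_closed_neighbourhood_tendsto[OF M(1,2) C(1) False e(1) e0] LIM_zero by blast
      have nb: "{x. infdist x C \<le> e k} \<in> sets M" for k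
        using M(2) by (auto intro!: borel_closed closed_Collect_le continuous_intros)
      have "\<bar>measure M (A \<inter> (T ^^ q k) -` C) - measure M (A \<inter> C)\<bar> \<le> r k" for k
      proof -
        let ?D = "(T ^^ q k) -` C"
        have D: "?D \<in> sets M" "measure M ?D = measure M C" using V[OF C(3)] by auto
        have "AE x in M. x \<in> ?D - C \<longrightarrow> x \<in> {x. infdist x C \<le> e k} - C"
          using e(2)[of k]
        proof eventually_elim
          case (elim x)
          show ?case using infdist_le2[of "(T ^^ q k) x" C x "e k"] elim by (auto simp: dist_commute)
        qed
        then have "measure M (?D - C) \<le> measure M ({x. infdist x C \<le> e k} - C)"
          using C D nb by (intro finite_measure_mono_AE) auto
        also have "\<dots> = r k"
          unfolding r_def using C nb e0 by (intro finite_measure_Diff) auto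
        finally have 1: "measure M (?D - C) \<le> r k" .
        \<comment> \<open>Closeness to the identity controls only the difference in one direction.
          The two sets have equal measure by invariance, so removing their intersection leaves equal
          remainders.\<close>
        have "measure M (C - ?D) = measure M (?D - C)"
          using finite_measure_Diff'[of C ?D] finite_measure_Diff'[of ?D C] C D by (simp add: Int_commute)
        with 1 have 2: "measure M (C - ?D) \<le> r k" by simp
        have As: "A \<in> sets M" using A M(2) by simp
        have "measure M (A \<inter> ?D) \<le> measure M ((A \<inter> C) \<union> (?D - C))"
          using As C D by (intro finite_measure_mono) auto
        also have "\<dots> \<le> measure M (A \<inter> C) + measure M (?D - C)"
          using As C D by (intro measure_Un_le) auto
        finally have 3: "measure M (A \<inter> ?D) \<le> measure M (A \<inter> C) + r k" using 1 by simp
        have "measure M (A \<inter> C) \<le> measure M ((A \<inter> ?D) \<union> (C - ?D))"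
          using As C D by (intro finite_measure_mono) auto
        also have "\<dots> \<le> measure M (A \<inter> ?D) + measure M (C - ?D)"
          using As C D by (intro measure_Un_le) auto
        finally show ?thesis using 2 3 by linarith
      qed
      then have "(\<lambda>k. measure M (A \<inter> (T ^^ q k) -` C) - measure M (A \<inter> C)) \<longlonglongrightarrow> 0"
        by (intro Lim_null_comparison[OF _ r]) auto
      then show ?thesis by (rule LIM_zero_cancel)
    qed
  next
    case empty
    show ?case by simp
  next
    case (compl B)
    then have B: "B \<in> sets borel" by (simp add: borel_eq_closed)
    have As: "A \<in> sets M" using A M(2) by simp
    have *: "measure M (A \<inter> (UNIV - D)) = measure M A - measure M (A \<inter> D)" if "D \<in> sets M" for D
    proof -
      have "A \<inter> (UNIV - D) = A - D" by auto
      then show ?thesis using finite_measure_Diff'[OF As that] by simp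
    qed
    have "(T ^^ q k) -` (UNIV - B) = UNIV - (T ^^ q k) -` B" for k by auto
    then show ?case
      using * V[OF B] B M(2) compl(2) by (auto intro!: tendsto_diff)
  next
    case (union B)
    then have B: "B i \<in> sets borel" for i by (auto simp: borel_eq_closed)
    have As: "A \<in> sets M" using A M(2) by simp
    have sums: "(\<lambda>i. measure M (A \<inter> D i)) sums measure M (A \<inter> (\<Union>i. D i))"
      if "disjoint_family D" "\<And>i. D i \<in> sets M" for D
    proof -
      have "(\<lambda>i. measure M (A \<inter> D i)) sums measure M (\<Union>i. A \<inter> D i)"
        using that As by (intro finite_measure_UNION) (auto simp: disjoint_family_on_def)
      then show ?thesis by simp
    qed
    have dis: "disjoint_family (\<lambda>i. (T ^^ q k) -` B i)" for k
      using union(1) by (auto simp: disjoint_family_on_def)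
    \<comment> \<open>A dominating sequence for exchanging the limit in k with the sum over i; by
      invariance the bound does not depend on k.\<close>
    have bound: "\<forall>\<^sub>F (i, k) in at_top \<times>\<^sub>F sequentially. norm (measure M (A \<inter> (T ^^ q k) -` B i)) \<le> measure M (B i)"
    proof (rule always_eventually, safe)
      fix i k
      have "measure M (A \<inter> (T ^^ q k) -` B i) \<le> measure M ((T ^^ q k) -` B i)"
        using V[OF B] by (intro finite_measure_mono) auto
      then show "norm (measure M (A \<inter> (T ^^ q k) -` B i)) \<le> measure M (B i)"
        using V[OF B] by simp
    qed
    have "(\<lambda>i. measure M (B i)) sums measure M (\<Union>i. B i)"
      using union(1) B M(2) by (intro finite_measure_UNION) auto
    then have "(\<lambda>k. \<Sum>i. measure M (A \<inter> (T ^^ q k) -` B i)) \<longlonglongrightarrow> (\<Sum>i. measure M (A \<inter> B i))"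
      using tannerys_theorem[OF union(3) bound sums_summable] by simp
    then show ?case
      using sums_unique[OF sums[OF dis]] sums_unique[OF sums[OF union(1)]] V[OF B] B M(2)
      by (simp add: vimage_UN)
  qed
qed

section \<open>The odometer\<close>

lemma expectation_floor_uniform:
  fixes g :: "nat \<Rightarrow> real"
  assumes "0 < n"
  shows "(\<integral>t. g (nat \<lfloor>t * real n\<rfloor>) \<partial>restrict_space lborel {0..<1::real}) = (\<Sum>i<n. g i) / real n"
proof -
  let ?M = "restrict_space lborel {0..<1::real}"
  let ?I = "\<lambda>i. {real i / real n..<real (Suc i) / real n}"
  interpret prob_space ?M by (rule prob_space_restrict_space) auto
  have I: "?I i \<subseteq> {0..<1}" if "i < n" for i
    using that assms by (auto simp: field_simps intro: order_trans less_le_trans)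
  have Im: "?I i \<in> sets ?M" "measure ?M (?I i) = 1 / real n" if "i < n" for i
  proof -
    show "?I i \<in> sets ?M" using I[OF that] by (simp add: sets_restrict_space_iff)
    have "measure ?M (?I i) = measure lborel (?I i)"
      using I[OF that] by (intro measure_restrict_space) auto
    also have "\<dots> = 1 / real n" using assms by (simp add: divide_right_mono add_divide_distrib)
    finally show "measure ?M (?I i) = 1 / real n" .
  qed
  have "g (nat \<lfloor>t * real n\<rfloor>) = (\<Sum>i<n. g i * indicator (?I i) t)" if t: "t \<in> {0..<1}" for t
  proof -
    define j where "j = nat \<lfloor>t * real n\<rfloor>"
    have "0 \<le> t * real n" "t * real n < real n" using t assms by auto
    then have j: "j < n" unfolding j_def by linarith
    have iff: "t \<in> ?I i \<longleftrightarrow> i = j" for i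
    proof -
      have "t \<in> ?I i \<longleftrightarrow> real i \<le> t * real n \<and> t * real n < real i + 1"
        using assms by (auto simp: field_simps)
      also have "\<dots> \<longleftrightarrow> i = j" using \<open>0 \<le> t * real n\<close> unfolding j_def by linarith
      finally show ?thesis .
    qed
    have "(\<Sum>i<n. g i * indicator (?I i) t) = (\<Sum>i<n. if i = j then g i else 0)"
      by (intro sum.cong refl) (simp only: indicator_def iff, simp)
    also have "\<dots> = g j" using j by simp
    finally show ?thesis by (simp add: j_def)
  qed
  then have "(\<integral>t. g (nat \<lfloor>t * real n\<rfloor>) \<partial>?M) = (\<integral>t. (\<Sum>i<n. g i * indicator (?I i) t) \<partial>?M)"
    by (intro Bochner_Integration.integral_cong) (auto simp: space_restrict_space)
  also have "\<dots> = (\<Sum>i<n. g i * measure ?M (?I i))"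
    using Im by (subst Bochner_Integration.integral_sum) (auto simp: less_top[symmetric])
  also have "\<dots> = (\<Sum>i<n. g i) / real n"
    using Im by (simp add: sum_divide_distrib)
  finally show ?thesis .
qed

text \<open>Mixed-radix digit reversal: \<open>digit_reversal q k i\<close> is the residue modulo \<open>q k\<close> whose digits with
  respect to \<open>q\<close> are, least significant first, those of \<open>i\<close>, most significant first.\<close>

primrec digit_reversal :: "(nat \<Rightarrow> nat) \<Rightarrow> nat \<Rightarrow> nat \<Rightarrow> nat" where
  "digit_reversal q 0 i = i"
| "digit_reversal q (Suc k) i = (let r = q (Suc k) div q k in
     digit_reversal q k (i div r) + q k * (i mod r))"

text \<open>The lower summand is below \<open>q k\<close>, so reduction modulo \<open>q k\<close>
  recovers it, and then the digit \<open>i mod r\<close>. Hence the map is injective, and an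
  injective self-map of a finite set is onto. The digit of level 0 is a full residue modulo
  \<open>q 0\<close>, which may exceed 1.\<close>

lemma digit_reversal_bij:
  assumes "\<And>k. 0 < q k" "\<And>k. q k dvd q (Suc k)"
  shows "bij_betw (digit_reversal q k) {..<q k} {..<q k}"
proof (induction k)
  case 0
  have "digit_reversal q 0 = id" by (simp add: fun_eq_iff)
  then show ?case by (simp only: bij_betw_id)
next
  case (Suc k)
  obtain r where r: "q (Suc k) = q k * r" using assms(2) by blast
  have r0: "0 < r" using assms(1)[of "Suc k"] r by simp
  have step: "digit_reversal q (Suc k) i = digit_reversal q k (i div r) + q k * (i mod r)" for i
    using r assms(1)[of k] by simp
  have d: "i div r < q k" "digit_reversal q k (i div r) < q k" if "i < q (Suc k)" for i
  proof -
    show "i div r < q k" using that r r0 by (simp add: less_mult_imp_div_less)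
    then show "digit_reversal q k (i div r) < q k" using bij_betw_apply[OF Suc] by blast
  qed
  have inj: "inj_on (digit_reversal q (Suc k)) {..<q (Suc k)}"
  proof (rule inj_onI)
    fix i j assume ij: "i \<in> {..<q (Suc k)}" "j \<in> {..<q (Suc k)}"
      and eq: "digit_reversal q (Suc k) i = digit_reversal q (Suc k) j"
    have m: "digit_reversal q k (i div r) = digit_reversal q k (j div r)"
      using arg_cong[OF eq[unfolded step], of "\<lambda>x. x mod q k"] d[of i] d[of j] ij by simp
    then have "i mod r = j mod r" using eq[unfolded step] assms(1)[of k] by simp
    moreover have "i div r = j div r"
      using m bij_betw_imp_inj_on[OF Suc] d[of i] d[of j] ij by (auto dest: inj_onD)
    ultimately show "i = j" by (metis div_mult_mod_eq)
  qed
  have "digit_reversal q (Suc k) ` {..<q (Suc k)} \<subseteq> {..<q (Suc k)}"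
  proof safe
    fix i assume "i < q (Suc k)"
    have "digit_reversal q k (i div r) + q k * (i mod r) < q k + q k * (i mod r)"
      using d(2)[OF \<open>i < q (Suc k)\<close>] by simp
    also have "\<dots> = q k * Suc (i mod r)" by simp
    also have "\<dots> \<le> q k * r" using r0 by (intro mult_le_mono2) (simp add: Suc_leI)
    finally show "digit_reversal q (Suc k) i < q (Suc k)" unfolding step r .
  qed
  from inj endo_inj_surj[OF finite_lessThan this inj] show ?case
    unfolding bij_betw_def by blast
qed

text \<open>The measure \<open>M\<close> stands for Haar measure of the odometer with periods \<open>q k\<close>, and \<open>a k\<close> for the
  projection to the residues modulo \<open>q k\<close>.\<close>

lemma odometer_coordinates:
  fixes q :: "nat \<Rightarrow> nat"
  assumes q: "\<And>k. 0 < q k" "\<And>k. q k dvd q (Suc k)"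
  obtains M :: "real measure" and a :: "nat \<Rightarrow> real \<Rightarrow> nat"
  where "prob_space M" "\<And>k. a k \<in> measurable M (count_space UNIV)"
    "\<And>k t. t \<in> space M \<Longrightarrow> a k t < q k"
    "\<And>k t. t \<in> space M \<Longrightarrow> a (Suc k) t mod q k = a k t"
    "\<And>k g. (\<integral>t. g (a k t) \<partial>M) = (\<Sum>i<q k. g i) / real (q k)"
proof -
  define M where "M = restrict_space lborel {0..<1::real}"
  \<comment> \<open>Passing from intervals of length \<open>1 / q (Suc k)\<close> to those of length
    \<open>1 / q k\<close> drops the least significant digit (\<open>div\<close>), while the
    odometer has to drop the most significant one (\<open>mod\<close>). Reversing the digits
    exchanges the two.\<close>
  define a where "a k t = digit_reversal q k (nat \<lfloor>t * real (q k)\<rfloor>)" for k t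
  note bij = digit_reversal_bij[of q, OF q]
  have lt: "nat \<lfloor>t * real (q k)\<rfloor> < q k" if "t \<in> space M" for k t
  proof -
    have "0 \<le> t * real (q k)" "t * real (q k) < real (q k)"
      using that q(1)[of k] by (auto simp: M_def space_restrict_space)
    then show ?thesis by linarith
  qed
  have a_lt: "a k t < q k" if "t \<in> space M" for k t
    using bij_betw_apply[OF bij, of "nat \<lfloor>t * real (q k)\<rfloor>" k] lt[OF that] by (simp add: a_def)
  show ?thesis
  proof (rule that[of M a])
    show "prob_space M" unfolding M_def by (rule prob_space_restrict_space) auto
    have "(\<lambda>t. nat \<lfloor>t * real (q k)\<rfloor>) \<in> measurable lborel (count_space UNIV)" for k
      by measurable
    then have "(\<lambda>t. nat \<lfloor>t * real (q k)\<rfloor>) \<in> measurable M (count_space UNIV)" for k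
      unfolding M_def by (rule measurable_restrict_space1)
    then show "a k \<in> measurable M (count_space UNIV)" for k
      unfolding a_def[abs_def] by (rule measurable_compose) simp
    show "a k t < q k" if "t \<in> space M" for k t using a_lt[OF that] .
    show "a (Suc k) t mod q k = a k t" if "t \<in> space M" for k t
    proof -
      obtain r where r: "q (Suc k) = q k * r" using q(2) by blast
      have r0: "0 < r" using q(1)[of "Suc k"] r by simp
      have "\<lfloor>t * real (q (Suc k))\<rfloor> div int r = \<lfloor>t * real (q k)\<rfloor>"
        using floor_divide_real_eq_div[of "int r" "t * real (q (Suc k))"] r r0 by simp
      then have "nat \<lfloor>t * real (q (Suc k))\<rfloor> div r = nat \<lfloor>t * real (q k)\<rfloor>"
        by (metis nat_div_as_int nat_int div_int_pos_iff nat_eq_iff2 nat_div_distrib' of_nat_0_le_iff)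
      then have "a (Suc k) t = a k t + q k * (nat \<lfloor>t * real (q (Suc k))\<rfloor> mod r)"
        using r q(1)[of k] by (simp add: a_def)
      then show ?thesis using a_lt[OF that, of k] by simp
    qed
    show "(\<integral>t. g (a k t) \<partial>M) = (\<Sum>i<q k. g i) / real (q k)" for k and g :: "nat \<Rightarrow> real"
    proof -
      have "(\<integral>t. g (a k t) \<partial>M) = (\<Sum>i<q k. g (digit_reversal q k i)) / real (q k)"
        unfolding a_def M_def using expectation_floor_uniform[OF q(1), of "\<lambda>i. g (digit_reversal q k i)" k] .
      then show ?thesis using sum.reindex_bij_betw[OF bij, of g k] by simp
    qed
  qed
qed

section \<open>Approximating invariant measures by periodic pseudo-orbits\<close>

lemma successively_orbit_segment:
  assumes "0 < \<delta>"
  shows "successively (\<lambda>a b. dist (T a) b < \<delta>) (map (\<lambda>i. (T ^^ i) u) [0..<n])"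
  using assms by (simp add: successively_conv_nth)

text \<open>Finitely many balls of radius \<delta> / 2 cover the space, and transitivity yields one
  orbit segment for each ordered pair of them. These finitely many segments have bounded length, so
  the price of a connection is independent of its end points.\<close>

lemma bounded_connecting_chains:
  fixes T :: "'a::metric_space \<Rightarrow> 'a"
  assumes "dynamical_system T" "transitive_system T" "0 < \<delta>"
  obtains L where "\<And>x y. \<exists>C. length C \<le> L \<and> successively (\<lambda>a b. dist (T a) b < \<delta>) (x # C @ [y])"
proof -
  have "compact (UNIV :: 'a set)" using assms by (simp add: dynamical_system_def)
  moreover have "(UNIV :: 'a set) \<subseteq> (\<Union>c\<in>UNIV. ball c (\<delta> / 2))"
    using assms(3) by (auto intro: centre_in_ball[THEN iffD2])
  ultimately obtain K where K: "finite K" "(UNIV :: 'a set) \<subseteq> (\<Union>c\<in>K. ball c (\<delta> / 2))"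
    using compactE_image[of UNIV UNIV "\<lambda>c::'a. ball c (\<delta> / 2)"] open_ball by metis
  have "\<exists>n u. 0 < n \<and> u \<in> ball c (\<delta> / 2) \<and> (T ^^ n) u \<in> ball c' (\<delta> / 2)" for c c'
  proof -
    have "ball c (\<delta> / 2) \<noteq> {}" "ball c' (\<delta> / 2) \<noteq> {}" using assms(3) by auto
    then obtain n where "0 < n" "(T ^^ n) ` ball c (\<delta> / 2) \<inter> ball c' (\<delta> / 2) \<noteq> {}"
      using assms(2) open_ball unfolding transitive_system_def by metis
    then show ?thesis by blast
  qed
  then obtain n u where nu: "\<And>c c'. 0 < n c c'" "\<And>c c'. u c c' \<in> ball c (\<delta> / 2)"
      "\<And>c c'. (T ^^ n c c') (u c c') \<in> ball c' (\<delta> / 2)"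
    by metis
  have "\<exists>C. length C \<le> (\<Sum>q\<in>K \<times> K. n (fst q) (snd q)) \<and>
      successively (\<lambda>a b. dist (T a) b < \<delta>) (x # C @ [y])" for x y
  proof -
    obtain c where c: "c \<in> K" "T x \<in> ball c (\<delta> / 2)" using K(2) by blast
    obtain c' where c': "c' \<in> K" "y \<in> ball c' (\<delta> / 2)" using K(2) by blast
    obtain m where m: "n c c' = Suc m" using nu(1)[of c c'] gr0_implies_Suc by blast
    \<comment> \<open>The segment stops one step short, and \<open>y\<close> takes the place of the
      point at time \<open>n c c'\<close>. It is nonempty because transitivity provides a positive
      time.\<close>
    define C where "C = map (\<lambda>i. (T ^^ i) (u c c')) [0..<n c c']"
    have "n c c' \<le> (\<Sum>q\<in>K \<times> K. n (fst q) (snd q))"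
      using member_le_sum[of "(c, c')" "K \<times> K" "\<lambda>q. n (fst q) (snd q)"] K(1) c c' by simp
    moreover have "C \<noteq> []" "hd C = u c c'" "last C = (T ^^ m) (u c c')"
      using m by (simp_all add: C_def hd_map last_map del: upt_Suc)
    moreover have "dist (T x) (u c c') < \<delta>"
      using c(2) nu(2)[of c c'] dist_triangle_half_r[of c "T x" \<delta> "u c c'"] by simp
    moreover have "dist (T ((T ^^ m) (u c c'))) y < \<delta>"
      using c'(2) nu(3)[of c c'] dist_triangle_half_r[of c' "(T ^^ n c c') (u c c')" \<delta> y] m by simp
    moreover have "successively (\<lambda>a b. dist (T a) b < \<delta>) C"
      unfolding C_def by (rule successively_orbit_segment) fact
    ultimately show ?thesis
      by (intro exI[of _ C]) (auto simp: successively_Cons successively_append_iff C_def)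
  qed
  then show ?thesis by (rule that)
qed

lemma abs_sum_list_map_le:
  fixes f :: "'a \<Rightarrow> real"
  assumes "\<And>x. \<bar>f x\<bar> \<le> M"
  shows "\<bar>sum_list (map f xs)\<bar> \<le> real (length xs) * M"
proof (induction xs)
  case (Cons x xs)
  then show ?case using assms[of x] by (simp add: algebra_simps)
qed simp

text \<open>Segments of length N alternate with connecting chains of length at most L, and only the
  latter produce the error. The head of \<open>W\<close> is recorded so that another segment can be
  attached in front; taking \<open>hd xs\<close> for the free end point \<open>y\<close> closes the
  chain.\<close>

lemma concatenate_orbit_segments:
  fixes T :: "'a::metric_space \<Rightarrow> 'a" and F :: "('a \<Rightarrow> real) set"
  assumes L: "\<And>x y. \<exists>C. length C \<le> L \<and> successively (\<lambda>a b. dist (T a) b < \<delta>) (x # C @ [y])"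
    and "0 < \<delta>" "0 < N"
    and M: "\<And>f x. f \<in> F \<Longrightarrow> \<bar>f x\<bar> \<le> M" "0 \<le> M"
    and "xs \<noteq> []"
  shows "\<exists>W. W \<noteq> [] \<and> hd W = hd xs \<and> successively (\<lambda>a b. dist (T a) b < \<delta>) (W @ [y]) \<and>
    length xs * N \<le> length W \<and> length W \<le> length xs * (N + L) \<and>
    (\<forall>f\<in>F. \<bar>sum_list (map f W) - (\<Sum>x\<leftarrow>xs. \<Sum>i<N. f ((T ^^ i) x))\<bar> \<le> real (length xs) * real L * M)"
proof -
  let ?R = "\<lambda>a b. dist (T a) b < \<delta>"
  define orb where "orb x = map (\<lambda>i. (T ^^ i) x) [0..<N]" for x
  have orb: "orb x \<noteq> []" "hd (orb x) = x" "successively ?R (orb x)" "length (orb x) = N" for x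
    using successively_orbit_segment[OF \<open>0 < \<delta>\<close>] \<open>0 < N\<close>
    by (simp_all add: orb_def hd_map)
  have orb_sum: "sum_list (map f (orb x)) = (\<Sum>i<N. f ((T ^^ i) x))" for x and f :: "'a \<Rightarrow> real"
    by (simp add: orb_def comp_def interv_sum_list_conv_sum_set_nat atLeast0LessThan)
  have block: "\<exists>C. length C \<le> L \<and> (\<forall>f\<in>F. \<bar>sum_list (map f C)\<bar> \<le> real L * M) \<and>
      successively ?R (orb x @ C @ [y])" for x y
  proof -
    obtain C where C: "length C \<le> L" "successively ?R (last (orb x) # C @ [y])"
      using L by blast
    have "\<bar>sum_list (map f C)\<bar> \<le> real L * M" if "f \<in> F" for f
      using abs_sum_list_map_le[of f M C] M that C(1)
      by (meson mult_right_mono of_nat_le_iff order_trans)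
    moreover have "successively ?R (orb x @ C @ [y])"
      using C(2) orb(1,3)[of x]
      by (subst successively_append_iff) (simp add: successively_Cons)
    ultimately show ?thesis using C by blast
  qed
  show ?thesis
    using \<open>xs \<noteq> []\<close>
  proof (induction xs rule: list_nonempty_induct)
    case (single x)
    obtain C where "length C \<le> L" "\<forall>f\<in>F. \<bar>sum_list (map f C)\<bar> \<le> real L * M"
      "successively ?R (orb x @ C @ [y])"
      using block by blast
    then show ?case
      using orb[of x] orb_sum by (intro exI[of _ "orb x @ C"]) auto
  next
    case (cons x xs)
    then obtain W where W: "W \<noteq> []" "hd W = hd xs" "successively ?R (W @ [y])"
      "length xs * N \<le> length W" "length W \<le> length xs * (N + L)"
      "\<And>f. f\<in>F \<Longrightarrow> \<bar>sum_list (map f W) - (\<Sum>x\<leftarrow>xs. \<Sum>i<N. f ((T ^^ i) x))\<bar> \<le> real (length xs) * real L * M"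
      by blast
    obtain C where C: "length C \<le> L" "\<And>f. f\<in>F \<Longrightarrow> \<bar>sum_list (map f C)\<bar> \<le> real L * M"
      "successively ?R (orb x @ C @ [hd xs])"
      using block by blast
    have "successively ?R ((orb x @ C) @ [hd xs])" using C(3) by simp
    then have "successively ?R ((orb x @ C) @ (W @ [y]))"
      using W orb(1)[of x] unfolding successively_append_iff[of _ "orb x @ C"] by auto
    moreover have "\<bar>sum_list (map f (orb x @ C @ W)) - (\<Sum>x\<leftarrow>x # xs. \<Sum>i<N. f ((T ^^ i) x))\<bar>
        \<le> real (length (x # xs)) * real L * M" if "f \<in> F" for f
      using C(2)[OF that] W(6)[OF that] orb_sum[of f x] by (simp add: algebra_simps)
    ultimately show ?case
      using orb[of x] W C(1) by (intro exI[of _ "orb x @ C @ W"]) auto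
  qed
qed

text \<open>Greedy choice: the next point is picked so that the inner product of its deviation with the
  error accumulated so far is nonpositive, which exists because this inner product has mean zero.
  The squared error then grows only linearly.\<close>

lemma (in prob_space) sample_average_error:
  fixes g :: "'i \<Rightarrow> 'a \<Rightarrow> real"
  assumes "finite I" "\<And>i. i \<in> I \<Longrightarrow> integrable M (g i)" "\<And>i x. i \<in> I \<Longrightarrow> \<bar>g i x\<bar> \<le> B"
  shows "\<exists>xs. length xs = n \<and>
    (\<Sum>i\<in>I. (sum_list (map (g i) xs) - real n * expectation (g i))\<^sup>2) \<le> real n * (real (card I) * (2 * B)\<^sup>2)"
proof (induction n)
  case 0
  show ?case by simp
next
  case (Suc n)
  then obtain xs where xs: "length xs = n"
    "(\<Sum>i\<in>I. (sum_list (map (g i) xs) - real n * expectation (g i))\<^sup>2) \<le> real n * (real (card I) * (2 * B)\<^sup>2)"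
    by blast
  define e where "e i = sum_list (map (g i) xs) - real n * expectation (g i)" for i
  define d where "d i x = g i x - expectation (g i)" for i x
  have d_int: "integrable M (d i)" "expectation (d i) = 0" if "i \<in> I" for i
    unfolding d_def using assms(2)[OF that] by (auto simp: prob_space)
  have d_le: "(d i x)\<^sup>2 \<le> (2 * B)\<^sup>2" if "i \<in> I" for i x
  proof -
    have "\<bar>expectation (g i)\<bar> \<le> expectation (\<lambda>x. \<bar>g i x\<bar>)"
      by (rule integral_abs_bound)
    also have "\<dots> \<le> B"
      using assms that by (intro integral_le_const) auto
    finally have "\<bar>d i x\<bar> \<le> 2 * B"
      using assms(3)[OF that, of x] by (simp add: d_def)
    then have "\<bar>d i x\<bar>\<^sup>2 \<le> (2 * B)\<^sup>2" by (intro power_mono) auto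
    then show ?thesis by simp
  qed
  define h where "h x = (\<Sum>i\<in>I. e i * d i x)" for x
  have h_int: "integrable M h" "expectation h = 0"
    unfolding h_def using d_int by (auto simp: integral_sum)
  have "\<exists>x\<in>space M. h x \<le> 0"
  proof (rule ccontr)
    assume "\<not> ?thesis"
    then have "AE x in M. 0 < h x" by (intro AE_I2) (simp add: not_le)
    from expectation_greater[OF h_int(1) this] h_int(2) show False by simp
  qed
  then obtain x where x: "h x \<le> 0" by blast
  have "(\<Sum>i\<in>I. (sum_list (map (g i) (x # xs)) - real (Suc n) * expectation (g i))\<^sup>2)
      = (\<Sum>i\<in>I. (e i + d i x)\<^sup>2)"
    by (intro sum.cong refl) (simp add: e_def d_def algebra_simps)
  also have "\<dots> = (\<Sum>i\<in>I. (e i)\<^sup>2) + 2 * h x + (\<Sum>i\<in>I. (d i x)\<^sup>2)"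
    by (simp add: power2_sum h_def sum.distrib sum_distrib_left algebra_simps)
  also have "\<dots> \<le> real n * (real (card I) * (2 * B)\<^sup>2) + 0 + real (card I) * (2 * B)\<^sup>2"
    using xs(2) x sum_bounded_above[OF d_le] by (intro add_mono) (auto simp: e_def)
  also have "\<dots> = real (Suc n) * (real (card I) * (2 * B)\<^sup>2)"
    by (simp add: algebra_simps)
  finally show ?case using xs(1) by (intro exI[of _ "x # xs"]) simp
qed

text \<open>After n greedy choices the squared errors add up to at most n K, so each averaged error
  is at most the square root of K / n. This serves as a law of large numbers for finitely many
  functions at once.\<close>

lemma (in prob_space) sample_average_approximates:
  fixes g :: "'i \<Rightarrow> 'a \<Rightarrow> real"
  assumes "finite I" "\<And>i. i \<in> I \<Longrightarrow> integrable M (g i)" "\<And>i x. i \<in> I \<Longrightarrow> \<bar>g i x\<bar> \<le> B"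
    and "0 < \<epsilon>"
  shows "\<exists>xs. xs \<noteq> [] \<and> (\<forall>i\<in>I. \<bar>sum_list (map (g i) xs) / real (length xs) - expectation (g i)\<bar> \<le> \<epsilon>)"
proof -
  define K where "K = real (card I) * (2 * B)\<^sup>2"
  obtain n where n: "K / \<epsilon>\<^sup>2 < real n" using reals_Archimedean2 by blast
  have "0 \<le> K" by (simp add: K_def)
  then have "0 \<le> K / \<epsilon>\<^sup>2" by simp
  with n have n0: "0 < real n" by linarith
  obtain xs where xs: "length xs = n"
    "(\<Sum>i\<in>I. (sum_list (map (g i) xs) - real n * expectation (g i))\<^sup>2) \<le> real n * K"
    using sample_average_error[of I g B n, OF assms(1-3)] unfolding K_def by blast
  have "\<bar>sum_list (map (g i) xs) / real n - expectation (g i)\<bar> \<le> \<epsilon>" if "i \<in> I" for i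
  proof -
    define s where "s = sum_list (map (g i) xs) - real n * expectation (g i)"
    have "s\<^sup>2 \<le> (\<Sum>i\<in>I. (sum_list (map (g i) xs) - real n * expectation (g i))\<^sup>2)"
      unfolding s_def using assms(1) that by (intro member_le_sum[where i=i]) auto
    also have "\<dots> \<le> real n * K" by fact
    also have "\<dots> \<le> real n * (real n * \<epsilon>\<^sup>2)"
      using n n0 \<open>0 < \<epsilon>\<close> by (intro mult_left_mono) (auto simp: divide_simps)
    also have "\<dots> = (real n * \<epsilon>)\<^sup>2" by (simp add: power2_eq_square)
    finally have "\<bar>s\<bar> \<le> real n * \<epsilon>"
      using n0 \<open>0 < \<epsilon>\<close> by (simp add: abs_le_square_iff[symmetric] abs_mult)
    moreover have "sum_list (map (g i) xs) / real n - expectation (g i) = s / real n"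
      using n0 by (simp add: s_def field_simps)
    ultimately show ?thesis
      using n0 by (simp add: abs_divide divide_le_eq mult.commute)
  qed
  moreover have "xs \<noteq> []" using xs(1) n0 by auto
  ultimately show ?thesis using xs(1) by blast
qed

lemma compact_UNIV_bounded_real:
  fixes f :: "'a::metric_space \<Rightarrow> real"
  assumes "compact (UNIV :: 'a set)" "continuous_on UNIV f"
  shows "\<exists>B\<ge>0. \<forall>x. \<bar>f x\<bar> \<le> B"
proof -
  have "bounded (range f)"
    using assms compact_continuous_image compact_imp_bounded by blast
  then obtain B where B: "\<And>x. norm (f x) \<le> B" unfolding bounded_iff by auto
  then have "0 \<le> B" using norm_ge_zero order_trans by blast
  then show ?thesis using B by auto
qed

lemma finite_family_bounded_real:
  fixes F :: "('a::metric_space \<Rightarrow> real) set"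
  assumes "compact (UNIV :: 'a set)" "finite F" "\<And>f. f \<in> F \<Longrightarrow> continuous_on UNIV f"
  shows "\<exists>B>0. \<forall>f\<in>F. \<forall>x. \<bar>f x\<bar> \<le> B"
  using assms(2,3)
proof (induction F)
  case empty
  show ?case by (intro exI[of _ 1]) simp
next
  case (insert f F)
  then obtain B where B: "0 < B" "\<forall>f\<in>F. \<forall>x. \<bar>f x\<bar> \<le> B" by auto
  obtain B' where B': "0 \<le> B'" "\<forall>x. \<bar>f x\<bar> \<le> B'"
    using compact_UNIV_bounded_real[OF assms(1), of f] insert.prems by auto
  have "\<bar>g x\<bar> \<le> B + B'" if "g \<in> insert f F" for g x
    using that B B' by (auto intro: order_trans[of _ B] order_trans[of _ B'])
  then show ?case using B B' by (intro exI[of _ "B + B'"]) auto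
qed

text \<open>By invariance the averages \<open>g f\<close> over N steps have the integral of f. A
  finite sample of starting points nearly realizes these integrals, and joining the orbit segments
  of the sample disturbs the averages only by the order of L / N.\<close>

lemma periodic_chain_approximates:
  fixes T :: "'a::metric_space \<Rightarrow> 'a" and F :: "('a \<Rightarrow> real) set"
  assumes T: "dynamical_system T" "transitive_system T"
    and \<mu>: "\<mu> \<in> invariant_measures T"
    and F: "finite F" "\<And>f. f \<in> F \<Longrightarrow> continuous_on UNIV f"
    and "0 < \<delta>" "0 < \<epsilon>"
  shows "\<exists>W. W \<noteq> [] \<and> successively (\<lambda>a b. dist (T a) b < \<delta>) (W @ [hd W]) \<and>
    (\<forall>f\<in>F. \<bar>sum_list (map f W) / real (length W) - (\<integral>x. f x \<partial>\<mu>)\<bar> < \<epsilon>)"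
proof -
  interpret prob_space \<mu> using \<mu> by (simp add: invariant_measures_def)
  have sets: "sets \<mu> = sets borel" and inv: "distr \<mu> borel T = \<mu>"
    using \<mu> by (simp_all add: invariant_measures_def)
  have meas: "measurable \<mu> N = measurable borel N" for N :: "'x measure"
    by (rule measurable_cong_sets[OF sets refl])
  have contT: "continuous_on UNIV T" and cpt: "compact (UNIV :: 'a set)"
    using T by (simp_all add: dynamical_system_def)
  have Tm: "T \<in> measurable borel borel"
    using contT by (rule borel_measurable_continuous_onI)
  note D = distr_funpow[OF inv Tm sets]
  obtain B where B: "0 < B" "\<And>f x. f \<in> F \<Longrightarrow> \<bar>f x\<bar> \<le> B"
    using finite_family_bounded_real[OF cpt F] by blast
  obtain L where L: "\<And>x y. \<exists>C. length C \<le> L \<and> successively (\<lambda>a b. dist (T a) b < \<delta>) (x # C @ [y])"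
    using bounded_connecting_chains[OF T \<open>0 < \<delta>\<close>] by blast
  \<comment> \<open>Joining the segments causes two errors of at most B L / N each, one from the
    values on the connections and one from dividing by the true length of the chain. Half of
    \<epsilon> goes to the sample, so each of them has to stay below \<epsilon> / 4.\<close>
  obtain N where N: "4 * B * real L / \<epsilon> < real N" using reals_Archimedean2 by blast
  have "0 \<le> 4 * B * real L / \<epsilon>" using B \<open>0 < \<epsilon>\<close> by simp
  with N have N0: "0 < N" by linarith
  define g where "g f x = (\<Sum>i<N. f ((T ^^ i) x)) / real N" for f and x
  have fm: "f \<in> borel_measurable borel" if "f \<in> F" for f
    using F(2)[OF that] by (rule borel_measurable_continuous_onI)
  have f_int: "integrable \<mu> f" if "f \<in> F" for f
    using B(2)[OF that] fm[OF that] by (intro integrable_const_bound[of _ B]) (auto simp: meas)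
  have fT_int: "integrable \<mu> (\<lambda>x. f ((T ^^ i) x))" "(\<integral>x. f ((T ^^ i) x) \<partial>\<mu>) = (\<integral>x. f x \<partial>\<mu>)"
    if "f \<in> F" for f i
  proof -
    show "integrable \<mu> (\<lambda>x. f ((T ^^ i) x))"
      using B(2)[OF that] measurable_compose[OF D(2) fm[OF that]]
      by (intro integrable_const_bound[of _ B]) (auto simp: meas)
    have "(\<integral>x. f x \<partial>\<mu>) = (\<integral>x. f x \<partial>distr \<mu> borel (T ^^ i))" by (simp only: D(1))
    also have "\<dots> = (\<integral>x. f ((T ^^ i) x) \<partial>\<mu>)"
      using D(2) fm[OF that] by (intro integral_distr) (auto simp: meas)
    finally show "(\<integral>x. f ((T ^^ i) x) \<partial>\<mu>) = (\<integral>x. f x \<partial>\<mu>)" by simp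
  qed
  have g_int: "integrable \<mu> (g f)" "expectation (g f) = (\<integral>x. f x \<partial>\<mu>)" if "f \<in> F" for f
  proof -
    show "integrable \<mu> (g f)" unfolding g_def using fT_int[OF that] by auto
    show "expectation (g f) = (\<integral>x. f x \<partial>\<mu>)"
      unfolding g_def using fT_int[OF that] N0 by (simp add: integral_sum)
  qed
  have g_le: "\<bar>g f x\<bar> \<le> B" if "f \<in> F" for f x
  proof -
    have "\<bar>\<Sum>i<N. f ((T ^^ i) x)\<bar> \<le> (\<Sum>i<N. \<bar>f ((T ^^ i) x)\<bar>)" by (rule sum_abs)
    also have "\<dots> \<le> real N * B" using sum_bounded_above[of "{..<N}" "\<lambda>i. \<bar>f ((T ^^ i) x)\<bar>" B] B(2)[OF that] by simp
    finally show ?thesis using N0 by (simp add: g_def abs_divide divide_le_eq mult.commute)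
  qed
  have "0 < \<epsilon> / 2" using \<open>0 < \<epsilon>\<close> by simp
  from sample_average_approximates[of F g B, OF F(1) g_int(1) g_le this]
  obtain xs where xs: "xs \<noteq> []"
    "\<And>f. f \<in> F \<Longrightarrow> \<bar>sum_list (map (g f) xs) / real (length xs) - expectation (g f)\<bar> \<le> \<epsilon> / 2"
    by blast
  define n where "n = length xs"
  have n0: "0 < n" using xs(1) by (simp add: n_def)
  have "\<exists>W. W \<noteq> [] \<and> hd W = hd xs \<and> successively (\<lambda>a b. dist (T a) b < \<delta>) (W @ [hd xs]) \<and>
    n * N \<le> length W \<and> length W \<le> n * (N + L) \<and>
    (\<forall>f\<in>F. \<bar>sum_list (map f W) - (\<Sum>x\<leftarrow>xs. \<Sum>i<N. f ((T ^^ i) x))\<bar> \<le> real n * real L * B)"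
    unfolding n_def by (rule concatenate_orbit_segments[OF L \<open>0 < \<delta>\<close> N0]) (use B xs(1) in auto)
  then obtain W where W: "W \<noteq> []" "hd W = hd xs" "successively (\<lambda>a b. dist (T a) b < \<delta>) (W @ [hd xs])"
    "n * N \<le> length W" "length W \<le> n * (N + L)"
    "\<And>f. f \<in> F \<Longrightarrow> \<bar>sum_list (map f W) - (\<Sum>x\<leftarrow>xs. \<Sum>i<N. f ((T ^^ i) x))\<bar> \<le> real n * real L * B"
    by blast
  define p where "p = real (length W)"
  define m where "m = real n * real N"
  have m0: "0 < m" using n0 N0 by (simp add: m_def)
  have mp: "m \<le> p" "p - m \<le> real n * real L"
  proof -
    show "m \<le> p" unfolding m_def p_def using W(4) by (metis of_nat_le_iff of_nat_mult)
    have "p \<le> real (n * (N + L))" unfolding p_def using W(5) of_nat_le_iff by blast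
    then show "p - m \<le> real n * real L" by (simp add: m_def algebra_simps)
  qed
  have small: "real n * real L * B / m < \<epsilon> / 4"
  proof -
    have "4 * B * real L < \<epsilon> * real N" using N \<open>0 < \<epsilon>\<close> by (simp add: divide_less_eq mult.commute)
    moreover have "real n * real L * B / m = B * real L / real N" using n0 by (simp add: m_def)
    ultimately show ?thesis using N0 by (simp add: divide_less_eq)
  qed
  have "\<bar>sum_list (map f W) / p - (\<integral>x. f x \<partial>\<mu>)\<bar> < \<epsilon>" if f: "f \<in> F" for f
  proof -
    define S where "S = sum_list (map f W)"
    define S' where "S' = (\<Sum>x\<leftarrow>xs. \<Sum>i<N. f ((T ^^ i) x))"
    have div: "(\<Sum>x\<leftarrow>ys. h x / c) = (\<Sum>x\<leftarrow>ys. h x) / c" for ys :: "'a list" and h and c :: real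
      by (induction ys) (simp_all add: add_divide_distrib)
    have "sum_list (map (g f) xs) = S' / real N"
      unfolding S'_def div[symmetric] by (simp add: g_def[abs_def])
    then have "S' / m = sum_list (map (g f) xs) / real n"
      by (simp add: m_def mult.commute)
    then have 1: "\<bar>S' / m - (\<integral>x. f x \<partial>\<mu>)\<bar> \<le> \<epsilon> / 2"
      using xs(2)[OF f] g_int(2)[OF f] by (simp add: n_def)
    have "\<bar>S / m - S' / m\<bar> = \<bar>S - S'\<bar> / m"
      using m0 by (simp add: diff_divide_distrib[symmetric] abs_divide)
    also have "\<dots> \<le> real n * real L * B / m"
      using W(6)[OF f] m0 unfolding S_def S'_def by (intro divide_right_mono) auto
    finally have 2: "\<bar>S / m - S' / m\<bar> < \<epsilon> / 4" using small by linarith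
    have "\<bar>S\<bar> \<le> p * B"
      unfolding S_def p_def using abs_sum_list_map_le[of f B W] B(2)[OF f] by simp
    then have Sp: "\<bar>S\<bar> / p \<le> B" using m0 mp by (simp add: divide_le_eq mult.commute)
    have "\<bar>S / p - S / m\<bar> = \<bar>S\<bar> / p * ((p - m) / m)"
    proof -
      have "S / p - S / m = - (S / p * ((p - m) / m))" using m0 mp by (simp add: field_simps)
      then show ?thesis using m0 mp by (simp add: abs_mult abs_divide)
    qed
    also have "\<dots> \<le> B * (real n * real L / m)"
      using Sp mp m0 B(1) by (intro mult_mono divide_right_mono) auto
    also have "\<dots> = real n * real L * B / m" by simp
    finally have 3: "\<bar>S / p - S / m\<bar> < \<epsilon> / 4" using small by linarith
    show ?thesis using 1 2 3 unfolding S_def[symmetric] by linarith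
  qed
  then show ?thesis using W by (intro exI[of _ W]) (simp add: p_def)
qed

section \<open>Regularly recurrent orbits by iterated shadowing\<close>

definition periodic_with :: "nat \<Rightarrow> (nat \<Rightarrow> 'a) \<Rightarrow> bool" where
  "periodic_with p w \<longleftrightarrow> (\<forall>n. w (n + p) = w n)"

lemma periodic_with_mult:
  assumes "periodic_with p w"
  shows "w (n + p * a) = w n"
proof (induction a)
  case (Suc a)
  have "w (n + p * Suc a) = w ((n + p * a) + p)" by (simp add: algebra_simps)
  also have "\<dots> = w n" using assms Suc unfolding periodic_with_def by simp
  finally show ?case .
qed simp

lemma periodic_with_mod:
  assumes "periodic_with p w" "p dvd q"
  shows "w (n mod q) = w n"
proof -
  obtain c where "q = p * c" using assms(2) by blast
  then have "n = n mod q + p * (c * (n div q))"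
    by (metis mod_mult_div_eq mult.assoc)
  then show ?thesis using periodic_with_mult[OF assms(1)] by metis
qed

lemma pseudo_orbit_of_closed_chain:
  assumes "W \<noteq> []" "successively (\<lambda>a b. dist (T a) b < \<delta>) (W @ [hd W])"
  shows "pseudo_orbit T \<delta> (\<lambda>n. W ! (n mod length W))" "periodic_with (length W) (\<lambda>n. W ! (n mod length W))"
proof -
  show "periodic_with (length W) (\<lambda>n. W ! (n mod length W))" by (simp add: periodic_with_def)
  show "pseudo_orbit T \<delta> (\<lambda>n. W ! (n mod length W))"
    unfolding pseudo_orbit_def
  proof
    fix n
    define i where "i = n mod length W"
    have i: "i < length W" using assms(1) by (simp add: i_def)
    have "dist (T ((W @ [hd W]) ! i)) ((W @ [hd W]) ! Suc i) < \<delta>"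
      using successively_nth[OF assms(2), of i] i by simp
    moreover have "(W @ [hd W]) ! Suc i = W ! (Suc n mod length W)"
    proof (cases "Suc i = length W")
      case True
      then show ?thesis using assms(1) by (simp add: nth_append mod_Suc i_def hd_conv_nth)
    next
      case False
      then have "Suc i < length W" using i by simp
      then show ?thesis by (simp add: nth_append mod_Suc i_def)
    qed
    ultimately show "dist (T (W ! (n mod length W))) (W ! (Suc n mod length W)) < \<delta>"
      using i by (simp add: nth_append i_def)
  qed
qed

text \<open>Compactness gives two times \<open>p * a < p * b\<close> at which the orbit of y is
  \<delta>-close to itself. Repeating the piece between them gives a pseudo-orbit that jumps only at
  the ends of its periods. It stays \<eta>-close to w because its starting time and its length are
  multiples of the period of w.\<close>

lemma refine_periodic_pseudo_orbit:
  fixes T :: "'a::metric_space \<Rightarrow> 'a"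
  assumes "compact (UNIV :: 'a set)"
    and w: "0 < p" "periodic_with p w" "traced_by T \<eta> w y" and "0 < \<delta>"
  shows "\<exists>w' p'. 0 < p' \<and> periodic_with p' w' \<and> pseudo_orbit T \<delta> w' \<and> p dvd p' \<and>
    (\<forall>n. dist (w' n) (w n) < \<eta>)"
proof -
  obtain l r where r: "strict_mono (r :: nat \<Rightarrow> nat)" "((\<lambda>j. (T ^^ (p * j)) y) \<circ> r) \<longlonglongrightarrow> l"
    using assms(1) unfolding compact_eq_seq_compact_metric seq_compact_def by blast
  then have "Cauchy ((\<lambda>j. (T ^^ (p * j)) y) \<circ> r)" by (intro LIMSEQ_imp_Cauchy)
  then obtain M where "\<And>m n. m \<ge> M \<Longrightarrow> n \<ge> M \<Longrightarrow> dist ((T ^^ (p * r m)) y) ((T ^^ (p * r n)) y) < \<delta>"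
    using \<open>0 < \<delta>\<close> unfolding Cauchy_def comp_def by blast
  then have close: "dist ((T ^^ (p * r (Suc M))) y) ((T ^^ (p * r M)) y) < \<delta>" by simp
  define a where "a = r M"
  define b where "b = r (Suc M)"
  have ab: "a < b" using r(1) by (simp add: a_def b_def strict_mono_Suc_iff)
  define z where "z = (T ^^ (p * a)) y"
  define p' where "p' = p * (b - a)"
  define w' where "w' n = (T ^^ (n mod p')) z" for n
  have p': "0 < p'" using w(1) ab by (simp add: p'_def)
  have z: "(T ^^ p') z = (T ^^ (p * b)) y"
  proof -
    have "p * b = p' + p * a" using ab by (simp add: p'_def algebra_simps diff_mult_distrib2)
    then show ?thesis by (simp add: z_def funpow_add)
  qed
  have "pseudo_orbit T \<delta> w'"
    unfolding pseudo_orbit_def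
  proof
    fix n
    show "dist (T (w' n)) (w' (Suc n)) < \<delta>"
    proof (cases "Suc (n mod p') = p'")
      case True
      then have "T (w' n) = (T ^^ p') z" by (metis comp_apply funpow.simps(2) w'_def)
      moreover have "w' (Suc n) = z" using True by (simp add: w'_def mod_Suc)
      ultimately show ?thesis using close z by (simp add: z_def a_def b_def)
    next
      case False
      then have "T (w' n) = w' (Suc n)" by (simp add: w'_def mod_Suc)
      then show ?thesis using \<open>0 < \<delta>\<close> by simp
    qed
  qed
  moreover have "dist (w' n) (w n) < \<eta>" for n
  proof -
    have "w n = w (n mod p')" using periodic_with_mod[OF w(2), of p' n] by (simp add: p'_def)
    also have "\<dots> = w (n mod p' + p * a)" using periodic_with_mult[OF w(2)] by simp
    finally have "w n = w (n mod p' + p * a)" .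
    moreover have "w' n = (T ^^ (n mod p' + p * a)) y" by (simp add: w'_def z_def funpow_add)
    ultimately show ?thesis using w(3) unfolding traced_by_def by metis
  qed
  moreover have "periodic_with p' w'" by (simp add: periodic_with_def w'_def)
  ultimately show ?thesis using p' by (intro exI[of _ w'] exI[of _ p']) (auto simp: p'_def)
qed

text \<open>The orbit of \<open>z\<close> is the uniform limit of periodic pseudo-orbits, each of which shadows the
  previous one up to summable errors.\<close>

lemma regularly_recurrent_shadowing:
  fixes T :: "'a::metric_space \<Rightarrow> 'a"
  assumes T: "dynamical_system T" "shadowing_property T" and "0 < \<epsilon>"
  shows "\<exists>\<delta>>0. \<forall>w p. 0 < p \<longrightarrow> periodic_with p w \<longrightarrow> pseudo_orbit T \<delta> w \<longrightarrow>
    (\<exists>z q e. (\<forall>k. 0 < q k) \<and> (\<forall>k. q k dvd q (Suc k)) \<and> q 0 = p \<and> e \<longlonglongrightarrow> (0::real) \<and>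
      (\<forall>n. dist ((T ^^ n) z) (w n) \<le> \<epsilon>) \<and>
      (\<forall>k n. dist ((T ^^ n) z) ((T ^^ (n mod q k)) z) \<le> e k))"
proof -
  have contT: "continuous_on UNIV T" and cpt: "compact (UNIV :: 'a set)"
    using T by (simp_all add: dynamical_system_def)
  \<comment> \<open>The tolerances from level k on add up to \<epsilon> / 2 ^ k, hence to \<epsilon>
    in total.\<close>
  define \<eta> where "\<eta> k = \<epsilon> / 2 ^ Suc k" for k
  have \<eta>: "0 < \<eta> k" for k using \<open>0 < \<epsilon>\<close> by (simp add: \<eta>_def)
  \<comment> \<open>The extra bound by \<open>\<eta> k\<close> makes the jumps of the k-th
    pseudo-orbit tend to 0, so that the limit is a true orbit.\<close>
  have "\<exists>\<delta>>0. \<delta> \<le> \<eta> k \<and> (\<forall>x. pseudo_orbit T \<delta> x \<longrightarrow> (\<exists>y. traced_by T (\<eta> k) x y))" for k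
  proof -
    obtain d where d: "0 < d" "\<forall>x. pseudo_orbit T d x \<longrightarrow> (\<exists>y. traced_by T (\<eta> k) x y)"
      using T(2) \<eta>[of k] unfolding shadowing_property_def by blast
    have "pseudo_orbit T d x" if "pseudo_orbit T (min d (\<eta> k)) x" for x
      using that by (auto simp: pseudo_orbit_def)
    then show ?thesis using d \<eta>[of k] by (intro exI[of _ "min d (\<eta> k)"]) auto
  qed
  then obtain \<delta> where \<delta>: "\<And>k. 0 < \<delta> k" "\<And>k. \<delta> k \<le> \<eta> k"
    "\<And>k x. pseudo_orbit T (\<delta> k) x \<Longrightarrow> \<exists>y. traced_by T (\<eta> k) x y"
    by metis
  have "\<exists>z q e. (\<forall>k. 0 < q k) \<and> (\<forall>k. q k dvd q (Suc k)) \<and> q 0 = p0 \<and> e \<longlonglongrightarrow> (0::real) \<and>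
      (\<forall>n. dist ((T ^^ n) z) (w0 n) \<le> \<epsilon>) \<and>
      (\<forall>k n. dist ((T ^^ n) z) ((T ^^ (n mod q k)) z) \<le> e k)"
    if w0: "0 < p0" "periodic_with p0 w0" "pseudo_orbit T (\<delta> 0) w0" for w0 p0
  proof -
    \<comment> \<open>The clause for k = 0 pins the initial state, since dependent choice reveals
      nothing about it beyond \<open>P 0\<close>.\<close>
    define P where "P k s \<longleftrightarrow> 0 < snd s \<and> periodic_with (snd s) (fst s) \<and> pseudo_orbit T (\<delta> k) (fst s) \<and>
      (k = 0 \<longrightarrow> s = (w0, p0))" for k and s :: "(nat \<Rightarrow> 'a) \<times> nat"
    define R where "R k s s' \<longleftrightarrow> snd s dvd snd s' \<and> (\<forall>n. dist (fst s' n) (fst s n) < \<eta> k)"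
      for k :: nat and s s' :: "(nat \<Rightarrow> 'a) \<times> nat"
    have "\<exists>s. \<forall>k. P k (s k) \<and> R k (s k) (s (Suc k))"
    proof (rule dependent_nat_choice)
      show "\<exists>s. P 0 s" using w0 by (intro exI[of _ "(w0, p0)"]) (simp add: P_def)
      fix s k assume s: "P k s"
      then have s': "0 < snd s" "periodic_with (snd s) (fst s)" "pseudo_orbit T (\<delta> k) (fst s)"
        by (simp_all add: P_def)
      obtain y where "traced_by T (\<eta> k) (fst s) y" using \<delta>(3)[OF s'(3)] ..
      from refine_periodic_pseudo_orbit[OF cpt s'(1,2) this \<delta>(1)[of "Suc k"]]
      obtain w' p' where "0 < p'" "periodic_with p' w'" "pseudo_orbit T (\<delta> (Suc k)) w'" "snd s dvd p'"
        "\<forall>n. dist (w' n) (fst s n) < \<eta> k"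
        by blast
      then show "\<exists>s'. P (Suc k) s' \<and> R k s s'"
        by (intro exI[of _ "(w', p')"]) (simp add: P_def R_def)
    qed
    then obtain s where s: "\<And>k. P k (s k)" "\<And>k. R k (s k) (s (Suc k))" by blast
    define w where "w k = fst (s k)" for k
    define q where "q k = snd (s k)" for k
    have q: "0 < q k" "q k dvd q (Suc k)" "periodic_with (q k) (w k)" "pseudo_orbit T (\<delta> k) (w k)"
      and step: "dist (w (Suc k) n) (w k n) < \<eta> k" for k n
      using s(1)[of k] s(2)[of k] by (auto simp: P_def R_def w_def q_def)
    have init: "w 0 = w0" "q 0 = p0" using s(1)[of 0] by (auto simp: P_def w_def q_def)
    \<comment> \<open>The bound is kept as a difference: \<epsilon> / 2 ^ k alone would not survive
      the induction step.\<close>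
    have near: "dist (w j n) (w k n) \<le> \<epsilon> / 2 ^ k - \<epsilon> / 2 ^ j" if "k \<le> j" for j k n
      using that
    proof (induction j rule: dec_induct)
      case base
      show ?case by simp
    next
      case (step j)
      have "dist (w (Suc j) n) (w k n) \<le> dist (w (Suc j) n) (w j n) + dist (w j n) (w k n)"
        by (rule dist_triangle)
      also have "\<dots> \<le> \<eta> j + (\<epsilon> / 2 ^ k - \<epsilon> / 2 ^ j)"
        using \<open>dist (w (Suc j) n) (w j n) < \<eta> j\<close> step.IH by simp
      finally show ?case by (simp add: \<eta>_def field_simps)
    qed
    have near': "dist (w j n) (w k n) \<le> \<epsilon> / 2 ^ k" if "k \<le> j" for j k n
      using near[OF that, of n] \<open>0 < \<epsilon>\<close> by (smt (verit) divide_pos_pos zero_less_power)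
    have lim0: "(\<lambda>k. \<epsilon> / 2 ^ k) \<longlonglongrightarrow> 0" by real_asymp
    have "convergent (\<lambda>k. w k n)" for n
    proof -
      have "Cauchy (\<lambda>k. w k n)"
      proof (rule metric_CauchyI)
        fix e :: real assume "0 < e"
        then obtain K where K: "\<epsilon> / 2 ^ K < e / 2"
          using order_tendstoD(2)[OF lim0, of "e / 2"] by (auto simp: eventually_sequentially)
        have "dist (w i n) (w j n) < e" if "K \<le> i" "K \<le> j" for i j
          using dist_triangle2[of "w i n" "w j n" "w K n"] near'[OF that(1), of n] near'[OF that(2), of n] K by linarith
        then show "\<exists>M. \<forall>m\<ge>M. \<forall>j\<ge>M. dist (w m n) (w j n) < e" by blast
      qed
      then show ?thesis
        using compact_imp_complete[OF cpt] unfolding complete_def convergent_def by blast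
    qed
    then obtain u where u: "\<And>n. (\<lambda>k. w k n) \<longlonglongrightarrow> u n" unfolding convergent_def by metis
    have uw: "dist (u n) (w k n) \<le> \<epsilon> / 2 ^ k" for n k
      by (rule LIMSEQ_le_const2[OF tendsto_dist[OF u[of n] tendsto_const]]) (use near' in blast)
    have "T (u n) = u (Suc n)" for n
    proof -
      have "(\<lambda>k. T (w k n)) \<longlonglongrightarrow> T (u n)"
        using contT u[of n] by (intro continuous_on_tendsto_compose[OF contT]) auto
      then have "(\<lambda>k. dist (T (w k n)) (w k (Suc n))) \<longlonglongrightarrow> dist (T (u n)) (u (Suc n))"
        using u[of "Suc n"] by (intro tendsto_dist)
      moreover have "(\<lambda>k. dist (T (w k n)) (w k (Suc n))) \<longlonglongrightarrow> 0"
      proof (rule tendsto_sandwich[OF _ _ tendsto_const lim0])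
        have "dist (T (w k n)) (w k (Suc n)) \<le> \<epsilon> / 2 ^ k" for k
        proof -
          have "dist (T (w k n)) (w k (Suc n)) < \<delta> k" using q(4) unfolding pseudo_orbit_def by blast
          also have "\<delta> k \<le> \<eta> k" by (rule \<delta>(2))
          also have "\<eta> k \<le> \<epsilon> / 2 ^ k" using \<open>0 < \<epsilon>\<close> by (simp add: \<eta>_def field_simps)
          finally show ?thesis by simp
        qed
        then show "\<forall>\<^sub>F k in sequentially. dist (T (w k n)) (w k (Suc n)) \<le> \<epsilon> / 2 ^ k" by simp
      qed simp
      ultimately have "dist (T (u n)) (u (Suc n)) = 0" by (rule LIMSEQ_unique)
      then show ?thesis by simp
    qed
    then have orbit: "(T ^^ n) (u 0) = u n" for n by (induction n) auto
    \<comment> \<open>One \<epsilon> / 2 ^ k for each of the two passages between the limit orbit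
      and the \<open>q k\<close>-periodic \<open>w k\<close>.\<close>
    have "dist (u n) (u (n mod q k)) \<le> 2 * (\<epsilon> / 2 ^ k)" for k n
    proof -
      have "w k (n mod q k) = w k n" using periodic_with_mod[OF q(3)] by simp
      then show ?thesis
        using dist_triangle2[of "u n" "u (n mod q k)" "w k n"] uw[of n k] uw[of "n mod q k" k] by simp
    qed
    moreover have "(\<lambda>k. 2 * (\<epsilon> / 2 ^ k)) \<longlonglongrightarrow> 0" by real_asymp
    moreover have "dist (u n) (w0 n) \<le> \<epsilon>" for n using uw[of n 0] init by simp
    ultimately show ?thesis
      using q init orbit
      by (intro exI[of _ "u 0"] exI[of _ q] exI[of _ "\<lambda>k. 2 * (\<epsilon> / 2 ^ k)"]) simp
  qed
  then show ?thesis using \<delta>(1)[of 0] by blast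
qed

section \<open>Measures on odometer orbits\<close>

text \<open>The hypothesis on e makes the orbit map from n to \<open>(T ^^ n) z\<close> uniformly
  continuous for the odometer topology, so it extends to a map \<open>\<phi>\<close> on the
  odometer. Residues modulo \<open>q k\<close> are uniformly distributed under Haar measure; hence
  the k-th approximation of \<open>\<phi>\<close> integrates f to exactly the orbit average over
  \<open>q k\<close> steps.\<close>

lemma odometer_orbit_measure:
  fixes T :: "'a::metric_space \<Rightarrow> 'a"
  assumes T: "dynamical_system T"
    and q: "\<And>k. 0 < q k" "\<And>k. q k dvd q (Suc k)"
    and e: "e \<longlonglongrightarrow> (0::real)" "\<And>k n. dist ((T ^^ n) z) ((T ^^ (n mod q k)) z) \<le> e k"
  obtains \<nu> where "\<nu> \<in> invariant_measures T" "measure_entropy \<nu> T = 0"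
    "\<And>f. continuous_on UNIV f \<Longrightarrow>
      (\<lambda>k. (\<Sum>i<q k. f ((T ^^ i) z)) / real (q k)) \<longlonglongrightarrow> (\<integral>x. f x \<partial>\<nu> :: real)"
proof -
  have contT: "continuous_on UNIV T" and cpt: "compact (UNIV :: 'a set)"
    using T by (simp_all add: dynamical_system_def)
  have Tm: "T \<in> measurable borel borel"
    using contT by (rule borel_measurable_continuous_onI)
  obtain M :: "real measure" and a where M: "prob_space M" and a: "\<And>k. a k \<in> measurable M (count_space UNIV)"
    "\<And>k t. t \<in> space M \<Longrightarrow> a k t < q k" "\<And>k t. t \<in> space M \<Longrightarrow> a (Suc k) t mod q k = a k t"
    "\<And>k g. (\<integral>t. g (a k t) \<partial>M) = (\<Sum>i<q k. g i :: real) / real (q k)"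
    by (rule odometer_coordinates[of q, OF q]) (rule that)
  interpret M: prob_space M by fact
  define u where "u n = (T ^^ n) z" for n
  have e': "dist (u n) (u (n mod q k)) \<le> e k" for n k using e(2) by (simp add: u_def)
  have dvd: "q k dvd q j" if "k \<le> j" for k j
    using that by (induction j rule: dec_induct) (auto intro: dvd_trans q(2))
  have compat: "a j t mod q k = a k t" if "k \<le> j" "t \<in> space M" for k j t
    using \<open>k \<le> j\<close>
  proof (induction j rule: dec_induct)
    case base
    show ?case using a(2)[OF that(2)] by simp
  next
    case (step j)
    have "a (Suc j) t mod q k = a (Suc j) t mod q j mod q k"
      using dvd[of k j] step.hyps by (simp add: mod_mod_cancel)
    then show ?case using a(3)[OF that(2)] step.IH by simp
  qed
  have "convergent (\<lambda>k. u (a k t))" if "t \<in> space M" for t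
  proof -
    have "Cauchy (\<lambda>k. u (a k t))"
    proof (rule metric_CauchyI)
      fix \<epsilon> :: real assume "0 < \<epsilon>"
      then obtain K where K: "e K < \<epsilon> / 2"
        using order_tendstoD(2)[OF e(1), of "\<epsilon> / 2"] by (auto simp: eventually_sequentially)
      have "dist (u (a i t)) (u (a j t)) < \<epsilon>" if "K \<le> i" "K \<le> j" for i j
        using dist_triangle2[of "u (a i t)" "u (a j t)" "u (a K t)"]
          e'[of "a i t" K] e'[of "a j t" K] K compat[OF that(1) \<open>t \<in> space M\<close>]
          compat[OF that(2) \<open>t \<in> space M\<close>] by simp
      then show "\<exists>N. \<forall>m\<ge>N. \<forall>n\<ge>N. dist (u (a m t)) (u (a n t)) < \<epsilon>" by blast
    qed
    then show ?thesis
      using compact_imp_complete[OF cpt] unfolding complete_def convergent_def by blast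
  qed
  then obtain \<phi> where \<phi>: "\<And>t. t \<in> space M \<Longrightarrow> (\<lambda>k. u (a k t)) \<longlonglongrightarrow> \<phi> t"
    unfolding convergent_def by metis
  have \<phi>m: "\<phi> \<in> borel_measurable M"
  proof (rule borel_measurable_LIMSEQ_metric[OF _ \<phi>])
    show "(\<lambda>t. u (a k t)) \<in> borel_measurable M" for k
      by (rule measurable_compose[OF a(1)]) simp
  qed
  define \<nu> where "\<nu> = distr M borel \<phi>"
  have \<nu>: "prob_space \<nu>" "sets \<nu> = sets borel"
    unfolding \<nu>_def using M.prob_space_distr[OF \<phi>m] by auto
  have lim: "(\<lambda>k. (\<Sum>i<q k. f (u i)) / real (q k)) \<longlonglongrightarrow> (\<integral>x. f x \<partial>\<nu>)"
    if f: "continuous_on UNIV f" for f :: "'a \<Rightarrow> real"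
  proof -
    have fm: "f \<in> borel_measurable borel" using f by (rule borel_measurable_continuous_onI)
    obtain B where B: "\<And>x. \<bar>f x\<bar> \<le> B" using compact_UNIV_bounded_real[OF cpt f] by blast
    have "(\<lambda>k. \<integral>t. f (u (a k t)) \<partial>M) \<longlonglongrightarrow> (\<integral>t. f (\<phi> t) \<partial>M)"
    proof (rule integral_dominated_convergence[where w = "\<lambda>_. B"])
      show "AE t in M. (\<lambda>k. f (u (a k t))) \<longlonglongrightarrow> f (\<phi> t)"
        by (intro AE_I2 continuous_on_tendsto_compose[OF f \<phi>]) auto
      show "(\<lambda>t. f (u (a k t))) \<in> borel_measurable M" for k
        by (rule measurable_compose[OF a(1)]) simp
      show "(\<lambda>t. f (\<phi> t)) \<in> borel_measurable M"
        by (rule measurable_compose[OF \<phi>m fm])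
    qed (use B in auto)
    also have "(\<integral>t. f (\<phi> t) \<partial>M) = (\<integral>x. f x \<partial>\<nu>)"
      unfolding \<nu>_def using \<phi>m fm by (rule integral_distr[symmetric])
    finally show ?thesis by (simp only: a(4)[of "\<lambda>n. f (u n)"])
  qed
  have Tm': "T \<in> measurable \<nu> borel" using Tm \<nu>(2) by (simp cong: measurable_cong_sets)
  have inv: "distr \<nu> borel T = \<nu>"
  proof (rule prob_space_eqI_continuous)
    show "prob_space (distr \<nu> borel T)" using prob_space.prob_space_distr[OF \<nu>(1) Tm'] .
    fix f :: "'a \<Rightarrow> real" assume f: "continuous_on UNIV f" and f1: "\<And>x. \<bar>f x\<bar> \<le> 1"
    have fT: "continuous_on UNIV (\<lambda>x. f (T x))"
      using continuous_on_compose2[OF f contT] by simp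
    \<comment> \<open>The averages of f \<circ> T and of f differ by the boundary term
      \<open>(f (u (q k)) - f (u 0)) / q k\<close>. The periods may stay bounded, so it is the
      numerator that has to vanish, and it does because \<open>q k mod q k = 0\<close>.\<close>
    have "(\<lambda>k. u (q k)) \<longlonglongrightarrow> u 0"
    proof (rule metric_tendsto_imp_tendsto[OF e(1)])
      have "dist (u (q k)) (u 0) \<le> dist (e k) 0" for k
        using e'[of "q k" k] by (simp add: dist_real_def)
      then show "\<forall>\<^sub>F k in sequentially. dist (u (q k)) (u 0) \<le> dist (e k) 0" by simp
    qed
    then have "(\<lambda>k. f (u (q k))) \<longlonglongrightarrow> f (u 0)"
      by (intro continuous_on_tendsto_compose[OF f]) auto
    then have "(\<lambda>k. f (u (q k)) - f (u 0)) \<longlonglongrightarrow> 0" using LIM_zero by blast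
    then have d0: "(\<lambda>k. (f (u (q k)) - f (u 0)) / real (q k)) \<longlonglongrightarrow> 0"
    proof (rule Lim_null_comparison[rotated, OF tendsto_rabs_zero])
      have "norm ((f (u (q k)) - f (u 0)) / real (q k)) \<le> \<bar>f (u (q k)) - f (u 0)\<bar>" for k
        using q(1)[of k] by (simp add: abs_divide divide_le_eq mult_le_cancel_left1)
      then show "\<forall>\<^sub>F k in sequentially.
          norm ((f (u (q k)) - f (u 0)) / real (q k)) \<le> \<bar>f (u (q k)) - f (u 0)\<bar>" by simp
    qed
    have "(\<Sum>i<q k. f (T (u i))) / real (q k) = (\<Sum>i<q k. f (u i)) / real (q k) + (f (u (q k)) - f (u 0)) / real (q k)" for k
    proof -
      have "(\<Sum>i<q k. f (T (u i))) = (\<Sum>i<q k. f (u (Suc i)))" by (simp add: u_def)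
      also have "\<dots> = (\<Sum>i<q k. f (u i)) + (f (u (q k)) - f (u 0))"
        using sum_lessThan_telescope[of "\<lambda>i. f (u i)" "q k"] by (simp add: sum_subtractf)
      finally show ?thesis by (simp add: add_divide_distrib)
    qed
    then have "(\<lambda>k. (\<Sum>i<q k. f (T (u i))) / real (q k)) \<longlonglongrightarrow> (\<integral>x. f x \<partial>\<nu>)"
      using tendsto_add[OF lim[OF f] d0] by simp
    then have "(\<integral>x. f (T x) \<partial>\<nu>) = (\<integral>x. f x \<partial>\<nu>)"
      using lim[OF fT] LIMSEQ_unique by blast
    moreover have "(\<integral>x. f x \<partial>distr \<nu> borel T) = (\<integral>x. f (T x) \<partial>\<nu>)"
      using Tm' borel_measurable_continuous_onI[OF f] by (rule integral_distr)
    ultimately show "(\<integral>x. f x \<partial>distr \<nu> borel T) = (\<integral>x. f x \<partial>\<nu>)" by simp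
  qed (use \<nu> in auto)
  have contTn: "continuous_on UNIV (T ^^ n)" for n
  proof (induction n)
    case (Suc n)
    then show ?case using continuous_on_compose2[OF contT Suc] by (simp add: comp_def)
  qed (simp add: id_def)
  \<comment> \<open>Times n and n + \<open>q k\<close> have the same residue modulo
    \<open>q k\<close>, whence two errors \<open>e k\<close> along the orbit. The weak inequality
    passes to the limit points \<open>\<phi> t\<close>, on which \<open>\<nu>\<close> lives.\<close>
  have "AE x in \<nu>. dist ((T ^^ q k) x) x \<le> 2 * e k" for k
  proof -
    have "dist ((T ^^ q k) (\<phi> t)) (\<phi> t) \<le> 2 * e k" if "t \<in> space M" for t
    proof (rule LIMSEQ_le_const2)
      show "(\<lambda>j. dist ((T ^^ q k) (u (a j t))) (u (a j t))) \<longlonglongrightarrow> dist ((T ^^ q k) (\<phi> t)) (\<phi> t)"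
        by (intro tendsto_dist \<phi>[OF that] continuous_on_tendsto_compose[OF contTn \<phi>[OF that]]) auto
      have "dist ((T ^^ q k) (u n)) (u n) \<le> 2 * e k" for n
      proof -
        have "(T ^^ q k) (u n) = u (q k + n)" by (simp add: u_def funpow_add)
        then show ?thesis
          using dist_triangle2[of "u (q k + n)" "u n" "u (n mod q k)"] e'[of "q k + n" k] e'[of n k] by simp
      qed
      then show "\<exists>N. \<forall>j\<ge>N. dist ((T ^^ q k) (u (a j t))) (u (a j t)) \<le> 2 * e k" by blast
    qed
    then show ?thesis
      unfolding \<nu>_def
      by (subst AE_distr_iff[OF \<phi>m])
        (auto intro!: borel_closed closed_Collect_le continuous_intros contTn)
  qed
  then have ent: "measure_entropy \<nu> T = 0"
    using tendsto_mult_right[OF e(1), of 2]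
    by (intro measure_entropy_eq_0_if_rigid[where q = q, OF \<nu> inv Tm q(1)]
        rigid_if_tendsto_id[where e = "\<lambda>k. 2 * e k", OF \<nu> inv Tm]) auto
  have "\<nu> \<in> invariant_measures T" using \<nu> inv by (simp add: invariant_measures_def)
  then show ?thesis
    by (rule that[OF _ ent]) (use lim in \<open>simp add: u_def\<close>)
qed

section \<open>Density and residuality\<close>

lemma finite_family_uniformly_continuous:
  fixes F :: "('a::metric_space \<Rightarrow> real) set"
  assumes "compact (UNIV :: 'a set)" "finite F" "\<And>f. f \<in> F \<Longrightarrow> continuous_on UNIV f" "0 < \<epsilon>"
  shows "\<exists>\<eta>>0. \<forall>f\<in>F. \<forall>x y. dist x y < \<eta> \<longrightarrow> \<bar>f x - f y\<bar> < \<epsilon>"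
  using assms(2,3)
proof (induction F)
  case empty
  show ?case by (intro exI[of _ 1]) simp
next
  case (insert f F)
  then obtain \<eta> where \<eta>: "0 < \<eta>" "\<forall>f\<in>F. \<forall>x y. dist x y < \<eta> \<longrightarrow> \<bar>f x - f y\<bar> < \<epsilon>" by auto
  have "uniformly_continuous_on UNIV f"
    using insert.prems by (intro compact_uniformly_continuous assms(1)) simp
  then obtain \<eta>' where \<eta>': "0 < \<eta>'" "\<forall>x y. dist x y < \<eta>' \<longrightarrow> \<bar>f x - f y\<bar> < \<epsilon>"
    using \<open>0 < \<epsilon>\<close> unfolding uniformly_continuous_on_def by (metis UNIV_I dist_commute dist_real_def)
  show ?case using \<eta> \<eta>' by (intro exI[of _ "min \<eta> \<eta>'"]) auto
qed

lemma sum_periodic: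
  fixes h :: "nat \<Rightarrow> real"
  assumes "periodic_with p h"
  shows "(\<Sum>i<p * c. h i) = real c * (\<Sum>i<p. h i)"
proof (induction c)
  case (Suc c)
  have "(\<Sum>i<p * Suc c. h i) = (\<Sum>i<p * c. h i) + (\<Sum>i=p * c..<p * c + p. h i)"
    using sum.atLeastLessThan_concat[of 0 "p * c" "p * c + p" h]
    by (simp add: atLeast0LessThan add.commute)
  also have "(\<Sum>i=p * c..<p * c + p. h i) = (\<Sum>i<p. h (i + p * c))"
    using sum.shift_bounds_nat_ivl[of h 0 "p * c" p] by (simp add: atLeast0LessThan add.commute)
  also have "\<dots> = (\<Sum>i<p. h i)" by (simp add: periodic_with_mult[OF assms])
  finally show ?case using Suc by (simp add: algebra_simps)
qed simp

text \<open>The average over the chain W matches \<mu> up to \<epsilon> / 2, and the orbit of z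
  follows W so closely that its averages over \<open>q k\<close> steps deviate by at most another
  \<epsilon> / 2. The second bound is the same for all k, so it passes to the integral against
  \<nu>.\<close>

lemma zero_entropy_measure_approximates:
  fixes T :: "'a::metric_space \<Rightarrow> 'a" and F :: "('a \<Rightarrow> real) set"
  assumes T: "dynamical_system T" "transitive_system T" "shadowing_property T"
    and \<mu>: "\<mu> \<in> invariant_measures T"
    and F: "finite F" "\<And>f. f \<in> F \<Longrightarrow> continuous_on UNIV f" and "0 < \<epsilon>"
  shows "\<exists>\<nu>\<in>invariant_measures T. measure_entropy \<nu> T = 0 \<and>
    (\<forall>f\<in>F. \<bar>(\<integral>x. f x \<partial>\<nu>) - (\<integral>x. f x \<partial>\<mu>)\<bar> < \<epsilon>)"
proof -
  have cpt: "compact (UNIV :: 'a set)" using T by (simp add: dynamical_system_def)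
  have \<epsilon>2: "0 < \<epsilon> / 2" using \<open>0 < \<epsilon>\<close> by simp
  obtain \<eta> where \<eta>: "0 < \<eta>" "\<And>f x y. f \<in> F \<Longrightarrow> dist x y < \<eta> \<Longrightarrow> \<bar>f x - f y\<bar> < \<epsilon> / 2"
    using finite_family_uniformly_continuous[OF cpt F \<epsilon>2] by blast
  \<comment> \<open>Half of \<eta>, because the orbit follows the chain only with a weak
    inequality.\<close>
  have \<eta>2: "0 < \<eta> / 2" using \<eta>(1) by simp
  obtain \<delta> where \<delta>: "0 < \<delta>" "\<And>w p. 0 < p \<Longrightarrow> periodic_with p w \<Longrightarrow> pseudo_orbit T \<delta> w \<Longrightarrow>
    (\<exists>z q e. (\<forall>k. 0 < q k) \<and> (\<forall>k. q k dvd q (Suc k)) \<and> q 0 = p \<and> e \<longlonglongrightarrow> (0::real) \<and>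
      (\<forall>n. dist ((T ^^ n) z) (w n) \<le> \<eta> / 2) \<and>
      (\<forall>k n. dist ((T ^^ n) z) ((T ^^ (n mod q k)) z) \<le> e k))"
    using regularly_recurrent_shadowing[OF T(1,3) \<eta>2] by blast
  obtain W where W: "W \<noteq> []" "successively (\<lambda>a b. dist (T a) b < \<delta>) (W @ [hd W])"
    "\<And>f. f \<in> F \<Longrightarrow> \<bar>sum_list (map f W) / real (length W) - (\<integral>x. f x \<partial>\<mu>)\<bar> < \<epsilon> / 2"
    using periodic_chain_approximates[OF T(1,2) \<mu> F \<delta>(1) \<epsilon>2] by blast
  define p where "p = length W"
  define w where "w n = W ! (n mod p)" for n
  have p: "0 < p" using W(1) by (simp add: p_def)
  have w: "periodic_with p w" "pseudo_orbit T \<delta> w"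
    using pseudo_orbit_of_closed_chain[OF W(1,2)] by (simp_all add: p_def w_def[abs_def])
  obtain z q e where q: "\<And>k. 0 < q k" "\<And>k. q k dvd q (Suc k)" "q 0 = p" and e: "e \<longlonglongrightarrow> (0::real)"
    and z: "\<And>n. dist ((T ^^ n) z) (w n) \<le> \<eta> / 2" "\<And>k n. dist ((T ^^ n) z) ((T ^^ (n mod q k)) z) \<le> e k"
    using \<delta>(2)[OF p w] by blast
  obtain \<nu> where \<nu>: "\<nu> \<in> invariant_measures T" "measure_entropy \<nu> T = 0"
    "\<And>f. continuous_on UNIV f \<Longrightarrow>
      (\<lambda>k. (\<Sum>i<q k. f ((T ^^ i) z)) / real (q k)) \<longlonglongrightarrow> (\<integral>x. f x \<partial>\<nu> :: real)"
    by (rule odometer_orbit_measure[OF T(1), of q e z, OF q(1,2) e z(2)]) (rule that)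
  have "\<bar>(\<integral>x. f x \<partial>\<nu>) - (\<integral>x. f x \<partial>\<mu>)\<bar> < \<epsilon>" if f: "f \<in> F" for f
  proof -
    have avg: "(\<Sum>i<q k. f (w i)) / real (q k) = sum_list (map f W) / real p" for k
    proof -
      have "q 0 dvd q k" by (induction k) (auto intro: dvd_trans q(2))
      then obtain c where c: "q k = p * c" using q(3) by auto
      have "periodic_with p (\<lambda>i. f (w i))" using w(1) by (simp add: periodic_with_def)
      then have "(\<Sum>i<q k. f (w i)) = real c * (\<Sum>i<p. f (w i))"
        unfolding c by (rule sum_periodic)
      also have "(\<Sum>i<p. f (w i)) = (\<Sum>i<p. f (W ! i))" by (simp add: w_def)
      also have "\<dots> = sum_list (map f W)"
        by (simp add: p_def sum_list_sum_nth atLeast0LessThan)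
      finally show ?thesis using c q(1)[of k] by (simp add: divide_simps)
    qed
    have "\<bar>(\<Sum>i<q k. f ((T ^^ i) z)) / real (q k) - sum_list (map f W) / real p\<bar> \<le> \<epsilon> / 2" for k
    proof -
      have "\<bar>f ((T ^^ i) z) - f (w i)\<bar> \<le> \<epsilon> / 2" for i
        using \<eta>(2)[OF f, of "(T ^^ i) z" "w i"] z(1)[of i] \<eta>(1) by simp
      then have "\<bar>\<Sum>i<q k. f ((T ^^ i) z) - f (w i)\<bar> \<le> real (q k) * (\<epsilon> / 2)"
        using sum_bounded_above[of "{..<q k}" "\<lambda>i. \<bar>f ((T ^^ i) z) - f (w i)\<bar>" "\<epsilon> / 2"]
        by (intro order_trans[OF sum_abs]) simp
      then have "\<bar>\<Sum>i<q k. f ((T ^^ i) z) - f (w i)\<bar> / real (q k) \<le> \<epsilon> / 2"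
        using q(1)[of k] by (simp add: divide_le_eq mult.commute)
      then show ?thesis
        unfolding avg[of k, symmetric] by (simp add: sum_subtractf diff_divide_distrib[symmetric] abs_divide)
    qed
    then have "\<bar>(\<integral>x. f x \<partial>\<nu>) - sum_list (map f W) / real p\<bar> \<le> \<epsilon> / 2"
      by (intro LIMSEQ_le_const2[OF tendsto_rabs[OF tendsto_diff[OF \<nu>(3)[OF F(2)[OF f]] tendsto_const]]]) blast
    with W(3)[OF f] show ?thesis unfolding p_def by linarith
  qed
  with \<nu> show ?thesis by blast
qed

text \<open>Integrals of single test functions generate the topology, so a neighbourhood involves
  only finitely many of them and one common tolerance. This reduces density to an approximation of
  finitely many integrals.\<close>

lemma invariant_measure_topology_neighbourhood:
  assumes "openin (invariant_measure_topology T) U" "\<mu> \<in> U"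
  shows "\<exists>F \<epsilon>. finite F \<and> (\<forall>f\<in>F. continuous_on UNIV f) \<and> 0 < \<epsilon> \<and>
    (\<forall>\<nu>\<in>invariant_measures T. (\<forall>f\<in>F. \<bar>(\<integral>x. f x \<partial>\<nu>) - (\<integral>x. f x \<partial>\<mu>)\<bar> < (\<epsilon>::real)) \<longrightarrow> \<nu> \<in> U)"
proof -
  let ?S = "{{\<mu> \<in> invariant_measures T. (\<integral>x. f x \<partial>\<mu>) \<in> U} | (f :: 'a \<Rightarrow> real) U.
        continuous_on UNIV f \<and> open U}"
  have "generate_topology_on ?S U"
    using assms(1) unfolding invariant_measure_topology_def by (rule openin_topology_generated_by)
  then show ?thesis
    using assms(2)
  proof (induction U rule: generate_topology_on.induct)
    case Empty
    then show ?case by simp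
  next
    case (Int a b)
    then have "\<mu> \<in> a" "\<mu> \<in> b" by auto
    from Int.IH(1)[OF this(1)] obtain F and \<epsilon> :: real where F: "finite F" "\<forall>f\<in>F. continuous_on UNIV f" "0 < \<epsilon>"
        "\<forall>\<nu>\<in>invariant_measures T. (\<forall>f\<in>F. \<bar>(\<integral>x. f x \<partial>\<nu>) - (\<integral>x. f x \<partial>\<mu>)\<bar> < \<epsilon>) \<longrightarrow> \<nu> \<in> a"
      by blast
    from Int.IH(2)[OF \<open>\<mu> \<in> b\<close>] obtain F' and \<epsilon>' :: real where F': "finite F'" "\<forall>f\<in>F'. continuous_on UNIV f" "0 < \<epsilon>'"
        "\<forall>\<nu>\<in>invariant_measures T. (\<forall>f\<in>F'. \<bar>(\<integral>x. f x \<partial>\<nu>) - (\<integral>x. f x \<partial>\<mu>)\<bar> < \<epsilon>') \<longrightarrow> \<nu> \<in> b"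
      by blast
    show ?case using F F' by (intro exI[of _ "F \<union> F'"] exI[of _ "min \<epsilon> \<epsilon>'"]) (simp add: ball_Un)
  next
    case (UN K)
    then obtain k where k: "k \<in> K" "\<mu> \<in> k" by blast
    from UN.IH[OF this] obtain F and \<epsilon> :: real where "finite F" "\<forall>f\<in>F. continuous_on UNIV f" "0 < \<epsilon>"
        "\<forall>\<nu>\<in>invariant_measures T. (\<forall>f\<in>F. \<bar>(\<integral>x. f x \<partial>\<nu>) - (\<integral>x. f x \<partial>\<mu>)\<bar> < \<epsilon>) \<longrightarrow> \<nu> \<in> k"
      by blast
    with k(1) show ?case by (intro exI[of _ F] exI[of _ \<epsilon>]) blast
  next
    case (Basis s)
    then obtain f :: "'a \<Rightarrow> real" and V where s: "s = {\<mu> \<in> invariant_measures T. (\<integral>x. f x \<partial>\<mu>) \<in> V}"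
      "continuous_on UNIV f" "open V" by blast
    have "(\<integral>x. f x \<partial>\<mu>) \<in> V" using Basis.prems by (simp add: s(1))
    then obtain \<epsilon> where \<epsilon>: "0 < \<epsilon>" "\<And>y. dist y (\<integral>x. f x \<partial>\<mu>) < \<epsilon> \<Longrightarrow> y \<in> V"
      using s(3) unfolding open_dist by blast
    show ?case
    proof (intro exI[of _ "{f}"] exI[of _ \<epsilon>] conjI ballI impI)
      fix \<nu> assume "\<nu> \<in> invariant_measures T"
        "\<forall>f\<in>{f}. \<bar>(\<integral>x. f x \<partial>\<nu>) - (\<integral>x. f x \<partial>\<mu>)\<bar> < \<epsilon>"
      then show "\<nu> \<in> s" using \<epsilon>(2) by (simp add: s(1) dist_real_def)
    qed (use s(2) \<epsilon>(1) in simp_all)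
  qed
qed

theorem proposition3p8:
  fixes T :: "'a::metric_space \<Rightarrow> 'a"
  assumes "dynamical_system T"
    and "transitive_system T"
    and "shadowing_property T"
  shows "dense_in (invariant_measure_topology T)
           {\<mu> \<in> invariant_measures T. measure_entropy \<mu> T = 0} \<and>
         (upper_semicontinuous_map (invariant_measure_topology T) (\<lambda>\<mu>. measure_entropy \<mu> T) \<longrightarrow>
          residual_in (invariant_measure_topology T)
           {\<mu> \<in> invariant_measures T. measure_entropy \<mu> T = 0})"
proof (intro conjI impI)
  let ?X = "invariant_measure_topology T"
  let ?Z = "{\<mu> \<in> invariant_measures T. measure_entropy \<mu> T = 0}"
  \<comment> \<open>This serves both density and the empty interior of the sets of large
    entropy.\<close>
  have meets: "\<exists>\<nu>\<in>?Z. \<nu> \<in> U" if U: "openin ?X U" "\<mu> \<in> U" for U \<mu>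
  proof -
    have \<mu>: "\<mu> \<in> invariant_measures T" using openin_subset[OF U(1)] U(2) by auto
    obtain F and \<epsilon> :: real where F: "finite F" "\<forall>f\<in>F. continuous_on UNIV f" "0 < \<epsilon>"
      "\<forall>\<nu>\<in>invariant_measures T. (\<forall>f\<in>F. \<bar>(\<integral>x. f x \<partial>\<nu>) - (\<integral>x. f x \<partial>\<mu>)\<bar> < \<epsilon>) \<longrightarrow> \<nu> \<in> U"
      using invariant_measure_topology_neighbourhood[OF U] by blast
    obtain \<nu> where "\<nu> \<in> invariant_measures T" "measure_entropy \<nu> T = 0"
      "\<forall>f\<in>F. \<bar>(\<integral>x. f x \<partial>\<nu>) - (\<integral>x. f x \<partial>\<mu>)\<bar> < \<epsilon>"
      using zero_entropy_measure_approximates[OF assms \<mu> F(1) _ F(3)] F(2) by blast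
    with F(4) show ?thesis by blast
  qed
  show "dense_in ?X ?Z"
    unfolding dense_in_def
  proof (intro conjI set_eqI iffI)
    fix \<mu> assume "\<mu> \<in> topspace ?X"
    then show "\<mu> \<in> ?X closure_of ?Z"
      unfolding in_closure_of using meets by blast
  qed (auto simp: in_closure_of)
  assume usc: "upper_semicontinuous_map ?X (\<lambda>\<mu>. measure_entropy \<mu> T)"
  \<comment> \<open>\<open>Suc n\<close> keeps the threshold positive: the value 1 / 0 = 0 would
    admit every invariant measure.\<close>
  define N where "N n = {\<mu> \<in> invariant_measures T. ennreal (1 / real (Suc n)) \<le> measure_entropy \<mu> T}" for n
  have "nowhere_dense_in ?X (N n)" for n
  proof -
    have "openin ?X {\<mu> \<in> topspace ?X. measure_entropy \<mu> T < ennreal (1 / real (Suc n))}"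
      using usc unfolding upper_semicontinuous_map_def by blast
    moreover have "topspace ?X - N n = {\<mu> \<in> topspace ?X. measure_entropy \<mu> T < ennreal (1 / real (Suc n))}"
      by (auto simp: N_def not_le)
    moreover have sub: "N n \<subseteq> topspace ?X" by (auto simp: N_def)
    ultimately have "closedin ?X (N n)" unfolding closedin_def by simp
    then have "?X closure_of N n = N n" by (simp add: closure_of_eq)
    moreover have "?X interior_of (N n) = {}"
    proof (rule ccontr)
      assume "?X interior_of (N n) \<noteq> {}"
      then obtain \<mu> where "\<mu> \<in> ?X interior_of (N n)" by blast
      with meets[OF openin_interior_of] obtain \<nu> where "measure_entropy \<nu> T = 0" "\<nu> \<in> ?X interior_of (N n)" by blast
      then have "ennreal (1 / real (Suc n)) \<le> 0"
        using interior_of_subset[of ?X "N n"] by (auto simp: N_def)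
      then show False by (simp add: ennreal_eq_0_iff del: of_nat_Suc)
    qed
    ultimately show ?thesis using sub by (simp add: nowhere_dense_in_def)
  qed
  moreover have "topspace ?X - ?Z = (\<Union>n. N n)"
  proof (intro equalityI subsetI)
    fix \<mu> assume "\<mu> \<in> topspace ?X - ?Z"
    then have \<mu>: "\<mu> \<in> invariant_measures T" "0 < measure_entropy \<mu> T" by (auto simp: zero_less_iff_neq_zero)
    have "\<exists>n. ennreal (1 / real (Suc n)) \<le> measure_entropy \<mu> T"
    \<comment> \<open>The entropy may be infinite, and then it exceeds every threshold.\<close>
    proof (cases "measure_entropy \<mu> T" rule: ennreal_cases)
      case (real r)
      then have "0 < r" using \<mu>(2) by simp
      then obtain n where "1 / real (Suc n) < r"
        using reals_Archimedean by (auto simp: inverse_eq_divide)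
      then have "ennreal (1 / real (Suc n)) \<le> ennreal r" by (intro ennreal_leI) simp
      then show ?thesis unfolding real(2) by blast
    qed simp
    then show "\<mu> \<in> (\<Union>n. N n)" using \<mu>(1) by (auto simp: N_def)
  next
    fix \<mu> assume "\<mu> \<in> (\<Union>n. N n)"
    then obtain n where "\<mu> \<in> N n" by blast
    then show "\<mu> \<in> topspace ?X - ?Z" by (auto simp: N_def ennreal_eq_0_iff simp del: of_nat_Suc)
  qed
  ultimately show "residual_in ?X ?Z"
    unfolding residual_in_def first_category_in_def
    by (auto intro!: exI[of _ "range N"])
qed

end
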